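(* Let $X$ be a Hausdorff space which is the image of a quotient map from some standard space. Then the following are equivalent: (i) $X$ is the image of an irreducible quotient map from a standard space; (ii) $X$ has a sequentially dense subset $E$ such that each $x\in E$ is a point of compact type of $X$, and $X$ and $E$ have properties (a) and (b): Property (a). Whenever $(x_m)$ is a sequence of distinct points in $E$ with limit $x_0\in X$, there is a subsequence $(x_n)$ such that for all sequences $(x_n^j)_j$ in $X$ with $x_n^j\to x_n$ as $j\to\infty$ (for each $n$) there exist natural numbers $k_n$ $(n\ge 1)$ such that the set $\{ x_n^j: n\ge 1, j\ge k_n\}$ has compact closure in $X$. Property (b). Whenever $(x_m)$ is a sequence of distinct points in $X$ with limit $x_0\in X$, there is a subsequence $(x_n)$ and sequences $(x_n^j)_j$ in $E$ with $x_n^j\to x_n$ as $j\to\infty$ (for each $n$) such that every diagonal sequence from the set $\{ x_n^j: n, j\ge 1\}$ converges to $x_0$. (iii) Whenever $q: Y \to X$ is a quotient map from a standard space $Y$, the restriction $q_*|V:V\to X$ is an irreducible quotient map from $V$ onto $X$, where $V$ is the closure in $Y_*$ of the set of singleton fibres of $Y_*$.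
   Context: A standard space is a locally compact separable metric space. A surjective map $r:Z\to X$ is irreducible if $Z$ has no proper closed subset $W$ with $r(W)=X$. Let $q:Y\to X$ be a quotient map from a standard space $Y$ to a Hausdorff space $X$. $\mathrm{Cl}(Y)$ denotes the set of all closed subsets of $Y$ with the Fell topology, which has as subbase the sets $\{F: F\cap K=\emptyset\}$ ($K\subseteq Y$ compact) and $\{F: F\cap U\neq\emptyset\}$ ($U\subseteq Y$ open). The fibres of $q$ (fibres of $Y$) are the sets $q^{-1}(x)$, $x\in X$. $Y_*$ is the set of non-empty members of the closure in $\mathrm{Cl}(Y)$ of the set of fibres, with the relative Fell topology. The map $q$ is constant on each $F\in Y_*$, and $q_*:Y_*\to X$ is defined by $q_*(F)=q(y)$ for $y\in F$; it is known that $Y_*$ is a standard space and $q_*$ is a quotient map. The set of singleton fibres of $Y_*$ is $\{z\in Y_*: q_*^{-1}(q_*(z))=\{z\}\}$. A point $x\in X$ is of compact type if there is a compact subset $K\subseteq X$ such that whenever $(x_n)$ is a sequence in $X$ converging to $x$, eventually $x_n$ belongs to $K$. A subset $E\subseteq X$ is sequentially dense if every point of $X$ is the limit of a sequence of points of $E$. A diagonal sequence from $\{x_n^j: n,j\ge 1\}$ is a sequence of the form $(x_n^{j_n})_{n\ge 1}$ with $j_n\ge 1$. *)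

theory Defs
  imports "HOL-Analysis.Analysis"
begin

text \<open>All spaces are abstract topologies, i.e. a space is a \<^typ>\<open>'a topology\<close> with carrier
  \<^const>\<open>topspace\<close>; only the values of maps on the carriers matter. Sequences are indexed
  from 0.\<close>

section \<open>Standard spaces and irreducible maps\<close>

definition standard_space :: "'a topology \<Rightarrow> bool" where
  "standard_space Y \<longleftrightarrow>
     metrizable_space Y \<and> locally_compact_space Y \<and> separable_space Y"

definition irreducible_map :: "'b topology \<Rightarrow> 'a topology \<Rightarrow> ('b \<Rightarrow> 'a) \<Rightarrow> bool" where
  "irreducible_map Z X r \<longleftrightarrow>
     r ` topspace Z = topspace X \<and>
     \<not> (\<exists>W. closedin Z W \<and> W \<subset> topspace Z \<and> r ` W = topspace X)"

section \<open>The Fell topology and the space of limits of fibres\<close>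

definition fell_topology :: "'b topology \<Rightarrow> 'b set topology" where
  "fell_topology Y = topology_generated_by
     ({{F. closedin Y F \<and> F \<inter> K = {}} | K. compactin Y K} \<union>
      {{F. closedin Y F \<and> F \<inter> U \<noteq> {}} | U. openin Y U})"

text \<open>Taking \<open>K = {}\<close> shows that the carrier is the set of all closed sets.\<close>

lemma topspace_fell_topology: "topspace (fell_topology Y) = {F. closedin Y F}"
  unfolding fell_topology_def by (auto intro!: exI[of _ "{}"])

definition fibre :: "'b topology \<Rightarrow> ('b \<Rightarrow> 'a) \<Rightarrow> 'a \<Rightarrow> 'b set" where
  "fibre Y q x = {y \<in> topspace Y. q y = x}"

definition star_space :: "'b topology \<Rightarrow> 'a topology \<Rightarrow> ('b \<Rightarrow> 'a) \<Rightarrow> 'b set topology" where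
  "star_space Y X q = subtopology (fell_topology Y)
     ((fell_topology Y closure_of (fibre Y q ` topspace X)) - {{}})"

text \<open>When \<open>q\<close> is constant on the non-empty set \<open>F\<close>, the image \<open>q ` F\<close> is a singleton and
  \<open>star_map q F\<close> is its element, the common value of \<open>q\<close> on \<open>F\<close>.\<close>

definition star_map :: "('b \<Rightarrow> 'a) \<Rightarrow> 'b set \<Rightarrow> 'a" where
  "star_map q F = the_elem (q ` F)"

definition singleton_fibres :: "'b topology \<Rightarrow> 'a topology \<Rightarrow> ('b \<Rightarrow> 'a) \<Rightarrow> 'b set set" where
  "singleton_fibres Y X q =
     {z \<in> topspace (star_space Y X q).
        fibre (star_space Y X q) (star_map q) (star_map q z) = {z}}"

definition core_set :: "'b topology \<Rightarrow> 'a topology \<Rightarrow> ('b \<Rightarrow> 'a) \<Rightarrow> 'b set set" where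
  "core_set Y X q = star_space Y X q closure_of singleton_fibres Y X q"

section \<open>Sequential notions\<close>

text \<open>The relation \<^const>\<open>limitin\<close> does not constrain early terms of a sequence, so membership of
  all terms in the relevant set is required explicitly.\<close>

definition seq_in :: "'a topology \<Rightarrow> 'a set \<Rightarrow> (nat \<Rightarrow> 'a) \<Rightarrow> 'a \<Rightarrow> bool" where
  "seq_in X S x l \<longleftrightarrow> range x \<subseteq> S \<and> limitin X x l sequentially"

definition compact_type_point :: "'a topology \<Rightarrow> 'a \<Rightarrow> bool" where
  "compact_type_point X x \<longleftrightarrow> x \<in> topspace X \<and>
     (\<exists>K. compactin X K \<and>
        (\<forall>s. seq_in X (topspace X) s x \<longrightarrow> eventually (\<lambda>n. s n \<in> K) sequentially))"

definition sequentially_dense :: "'a topology \<Rightarrow> 'a set \<Rightarrow> bool" where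
  "sequentially_dense X E \<longleftrightarrow>
     E \<subseteq> topspace X \<and> (\<forall>x \<in> topspace X. \<exists>s. seq_in X E s x)"

text \<open>In both properties \<open>r\<close> selects the subsequence, and \<open>s n j\<close> is the \<open>j\<close>-th term of a
  sequence converging to the \<open>n\<close>-th term \<open>x (r n)\<close> of that subsequence.\<close>

definition property_a :: "'a topology \<Rightarrow> 'a set \<Rightarrow> bool" where
  "property_a X E \<longleftrightarrow>
     (\<forall>x x0. inj x \<and> seq_in X E x x0 \<longrightarrow>
        (\<exists>r. strict_mono (r :: nat \<Rightarrow> nat) \<and>
           (\<forall>s :: nat \<Rightarrow> nat \<Rightarrow> 'a. (\<forall>n. seq_in X (topspace X) (s n) (x (r n))) \<longrightarrow>
              (\<exists>k :: nat \<Rightarrow> nat. compactin X (X closure_of {s n j | n j. k n \<le> j})))))"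

definition property_b :: "'a topology \<Rightarrow> 'a set \<Rightarrow> bool" where
  "property_b X E \<longleftrightarrow>
     (\<forall>x x0. inj x \<and> seq_in X (topspace X) x x0 \<longrightarrow>
        (\<exists>r (s :: nat \<Rightarrow> nat \<Rightarrow> 'a). strict_mono (r :: nat \<Rightarrow> nat) \<and>
           (\<forall>n. seq_in X E (s n) (x (r n))) \<and>
           (\<forall>j :: nat \<Rightarrow> nat. limitin X (\<lambda>n. s n (j n)) x0 sequentially)))"

section \<open>Conditions quantifying over standard spaces\<close>

text \<open>HOL cannot quantify over types inside a formula, so these two conditions quantify over the
  standard spaces whose points lie in a given type \<^typ>\<open>'b\<close>. A standard space has at most
  continuum many points, so for \<^typ>\<open>real\<close> they cover all standard spaces up to
  homeomorphism.\<close>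

definition irreducible_quotient_image :: "'b itself \<Rightarrow> 'a topology \<Rightarrow> bool" where
  "irreducible_quotient_image _ X \<longleftrightarrow>
     (\<exists>(Z :: 'b topology) r. standard_space Z \<and> quotient_map Z X r \<and> irreducible_map Z X r)"

definition star_maps_restrict_irreducibly :: "'b itself \<Rightarrow> 'a topology \<Rightarrow> bool" where
  "star_maps_restrict_irreducibly _ X \<longleftrightarrow>
     (\<forall>(Y :: 'b topology) q. standard_space Y \<and> quotient_map Y X q \<longrightarrow>
        (let V = subtopology (star_space Y X q) (core_set Y X q)
         in quotient_map V X (star_map q) \<and> irreducible_map V X (star_map q)))"

end

theory Submission
  imports Defs
begin

text \<open>
  Let \<open>q\<close> be a quotient map from a standard space \<open>Y\<close> onto \<open>X\<close>. Exhausting \<open>Y\<close> by compact sets and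
  taking images gives compact stages \<open>C 0 \<subseteq> C 1 \<subseteq> \<dots>\<close> that cover \<open>X\<close> and determine its topology: a set
  is closed if its traces on all stages are. Every compact set, and hence every convergent sequence,
  lies in one stage, and closures of subsets of a stage are reached by sequences (the locale
  \<open>sequential_k_omega_space\<close>). So statements about sequences become statements about the sets
  \<open>inner_stage n\<close>, the sequential interior of \<open>C n\<close>: a point is of compact type iff it lies in one
  of them. The conditions are proved equivalent in a cycle.

  From (i) to (ii). For an irreducible \<open>r\<close> on \<open>Z\<close>, a Baire argument shows that the points \<open>z\<close> which are
  alone in their fibre are dense in \<open>Z\<close> (\<open>unique_points_dense\<close>). The set \<open>E\<close> is the image of these
  points. Sequences converging to \<open>r z\<close> lift into a compact part of \<open>Z\<close>, where
  their only possible cluster point is \<open>z\<close>; therefore the image of each neighbourhood of \<open>z\<close> eventually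
  contains them (\<open>unique_point_image_nbhd\<close>), although it need not be a neighbourhood of \<open>r z\<close>.
  This gives compact type and property (a), and approximating a convergent sequence of lifts by
  unique points gives property (b).

  From (ii) to (iii). Property (a) implies, for points of compact type, that each convergent
  sequence in \<open>E\<close> stays in one \<open>inner_stage n\<close>. Together with (b) this implies that \<open>X\<close> is already determined by the compact
  sets \<open>core_stage n\<close>, the closures of the \<open>inner_stage n\<close> (\<open>properties_imp_core_determined\<close>).
  Then \<open>core_stage n\<close> is a sequential neighbourhood of each point of \<open>inner_stage n\<close>, which is a dense
  \<open>G\<^sub>\<delta>\<close> of \<open>core_stage n\<close>. The map sending \<open>x\<close> to its fibre is
  upper semicontinuous on \<open>core_stage n\<close> for the Fell topology, so it is continuous at generic
  points, and a generic \<open>x\<close> in \<open>inner_stage n\<close> has a singleton fibre in the star space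
  (\<open>regular_values_dense\<close>, \<open>regular_value_singleton_fibre\<close>). Compactness of the Fell topology then
  lifts each \<open>core_stage n\<close> into the closure of the singleton fibres, which makes the restricted
  star map a quotient map; irreducibility is immediate, since every closed set that maps onto \<open>X\<close>
  contains all singleton fibres.

  From (iii) to (i). The Fell topology of a standard space is compact and metrizable, and the
  star space is locally closed in it, so its closed subsets are again standard.
  A standard space has at most continuum many points, so all the standard spaces involved can be
  copied onto subsets of the real line.
\<close>

section \<open>Countability and metrizability\<close>

lemma separable_metrizable_imp_second_countable:
  assumes "metrizable_space X" "separable_space X"
  shows "second_countable X"
proof -
  obtain M d where M: "Metric_space M d" and X: "X = Metric_space.mtopology M d"
    using assms(1) unfolding metrizable_space_def by blast
  interpret Metric_space M d by (fact M)
  obtain C where C: "countable C" "C \<subseteq> M" "mtopology closure_of C = M"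
    using assms(2) unfolding separable_space_def X by auto
  define \<B> where "\<B> = (\<lambda>(c, n::nat). mball c (1 / Suc n)) ` (C \<times> UNIV)"
  have "countable \<B>"
    unfolding \<B>_def using C(1) by blast
  moreover have "\<exists>V\<in>\<B>. x \<in> V \<and> V \<subseteq> U" if U: "openin mtopology U" "x \<in> U" for U x
  proof -
    obtain r where r: "r > 0" "mball x r \<subseteq> U"
      using U unfolding openin_mtopology by blast
    have x: "x \<in> M" using U openin_subset by fastforce
    obtain n :: nat where n: "1 / Suc n < r / 2"
      using nat_approx_posE[of "r / 2"] r(1) by auto
    obtain c where c: "c \<in> C" "c \<in> mball x (1 / Suc n)"
      using C(3) x unfolding metric_closure_of by (smt (verit) mem_Collect_eq of_nat_0_less_iff zero_less_Suc zero_less_divide_1_iff)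
    have "mball c (1 / Suc n) \<subseteq> mball x r"
    proof
      fix y assume y: "y \<in> mball c (1 / Suc n)"
      have "d x y \<le> d x c + d c y"
        using triangle x c(2) y by auto
      also have "\<dots> < r" using c(2) y n by auto
      finally show "y \<in> mball x r" using x y by auto
    qed
    moreover have "x \<in> mball c (1 / Suc n)"
      using c(2) commute by auto
    ultimately show ?thesis
      using r(2) c(1) unfolding \<B>_def
      by (intro bexI[of _ "mball c (1 / Suc n)"] image_eqI[of _ _ "(c, n)"]) auto
  qed
  moreover have "\<forall>V\<in>\<B>. openin mtopology V"
    unfolding \<B>_def by auto
  ultimately show ?thesis
    unfolding second_countable_def X by (intro exI[of _ \<B>]) blast
qed

lemma compact_metrizable_imp_second_countable:
  assumes "metrizable_space X" "compact_space X"
  shows "second_countable X"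
proof -
  obtain M d where M: "Metric_space M d" and X: "X = Metric_space.mtopology M d"
    using assms(1) unfolding metrizable_space_def by blast
  interpret Metric_space M d by (fact M)
  have tb: "mtotally_bounded M"
    using assms(2) compactin_imp_mtotally_bounded unfolding X
    by (metis compact_space_def topspace_mtopology)
  have "\<forall>n::nat. \<exists>K. finite K \<and> K \<subseteq> M \<and> M \<subseteq> (\<Union>x\<in>K. mball x (1 / Suc n))"
    using tb unfolding mtotally_bounded_def by (simp del: of_nat_Suc)
  then obtain K where K: "\<And>n::nat. finite (K n) \<and> K n \<subseteq> M \<and> M \<subseteq> (\<Union>x\<in>K n. mball x (1 / Suc n))"
    by metis
  have "\<exists>y. (\<exists>n. y \<in> K n) \<and> y \<in> M \<and> d x y < r" if x: "x \<in> M" "r > 0" for x r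
  proof -
    obtain n :: nat where n: "1 / Suc n < r"
      using nat_approx_posE x(2) by blast
    obtain c where "c \<in> K n" "x \<in> mball c (1 / Suc n)"
      using K[of n] x(1) by blast
    then have "c \<in> K n" "c \<in> M" "d x c < r"
      using n commute by (auto simp del: of_nat_Suc)
    then show ?thesis by blast
  qed
  then have "mtopology closure_of (\<Union>n. K n) = M"
    unfolding metric_closure_of by (auto simp: in_mball Bex_def)
  moreover have "countable (\<Union>n. K n)" "(\<Union>n. K n) \<subseteq> M"
    using K by (auto intro: countable_finite)
  ultimately have "separable_space mtopology"
    unfolding separable_space_def by auto
  then show ?thesis
    using separable_metrizable_imp_second_countable assms(1) X by blast
qed

lemma metrizable_closure_of_sequence:
  assumes "metrizable_space X" "x \<in> X closure_of S"
  obtains s where "range s \<subseteq> S \<inter> topspace X" "limitin X s x sequentially"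
  using assms unfolding metrizable_space_def
  by (smt (verit, best) Metric_space.closure_of_sequentially Metric_space.topspace_mtopology mem_Collect_eq)

lemma metrizable_compactin_subsequence:
  fixes s :: "nat \<Rightarrow> 'a"
  assumes "metrizable_space X" "compactin X K" "range s \<subseteq> K"
  obtains l r where "l \<in> K" "strict_mono (r :: nat \<Rightarrow> nat)" "limitin X (s \<circ> r) l sequentially"
  using assms unfolding metrizable_space_def
  by (metis Metric_space.compactin_sequentially)

text \<open>The Urysohn functions of the countably many disjoint pairs from \<open>\<C>\<close> separate points, so they
  inject the compact space into a countable power of the real line.\<close>

lemma compact_Hausdorff_separated_imp_metrizable:
  fixes \<C> :: "'a set set"
  assumes "compact_space X" "Hausdorff_space X" "countable \<C>"
    and "\<And>C. C \<in> \<C> \<Longrightarrow> closedin X C"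
    and sep: "\<And>x y. \<lbrakk>x \<in> topspace X; y \<in> topspace X; x \<noteq> y\<rbrakk>
               \<Longrightarrow> \<exists>C\<in>\<C>. \<exists>D\<in>\<C>. x \<in> C \<and> y \<in> D \<and> disjnt C D"
  shows "metrizable_space X"
proof -
  define I where "I = {(C, D). C \<in> \<C> \<and> D \<in> \<C> \<and> disjnt C D}"
  have "I \<subseteq> \<C> \<times> \<C>" unfolding I_def by auto
  then have "countable I"
    using \<open>countable \<C>\<close> countable_subset countable_SIGMA by metis
  have "normal_space X"
    using assms(1,2) compact_Hausdorff_or_regular_imp_normal_space by blast
  have "\<exists>f. continuous_map X euclideanreal f \<and> f ` fst p \<subseteq> {0} \<and> f ` snd p \<subseteq> {1}"
    if p: "p \<in> I" for p
  proof -
    have "closedin X (fst p)" "closedin X (snd p)" "disjnt (fst p) (snd p)"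
      using p assms(4) unfolding I_def by auto
    then obtain f where "continuous_map X (top_of_set {0..1::real}) f" "f ` fst p \<subseteq> {0}" "f ` snd p \<subseteq> {1}"
      by (rule Urysohn_lemma[OF \<open>normal_space X\<close> _ _ _ zero_le_one])
    then show ?thesis
      by (intro exI[of _ f]) (simp add: continuous_map_in_subtopology)
  qed
  then obtain f where f: "\<And>p. p \<in> I \<Longrightarrow> continuous_map X euclideanreal (f p) \<and>
      f p ` fst p \<subseteq> {0} \<and> f p ` snd p \<subseteq> {1}"
    by metis
  define P where "P = product_topology (\<lambda>p. euclideanreal) I"
  define g where "g x = (\<lambda>p\<in>I. f p x)" for x
  have "countable {i \<in> I. \<not> (\<exists>a. topspace euclideanreal \<subseteq> {a})}"
    by (rule countable_subset[OF _ \<open>countable I\<close>]) auto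
  then have mP: "metrizable_space P"
    unfolding P_def metrizable_space_product_topology
    using metrizable_space_euclidean by blast
  have "continuous_map X P g"
    unfolding P_def continuous_map_componentwise g_def using f by auto
  moreover have "Hausdorff_space P"
    using mP by (rule metrizable_imp_Hausdorff_space)
  moreover have "inj_on g (topspace X)"
  proof (rule inj_onI, rule ccontr)
    fix x y assume xy: "x \<in> topspace X" "y \<in> topspace X" "g x = g y" "x \<noteq> y"
    then obtain C D where CD: "C \<in> \<C>" "D \<in> \<C>" "x \<in> C" "y \<in> D" "disjnt C D"
      using sep by blast
    then have "(C, D) \<in> I" unfolding I_def by auto
    with f[OF this] CD have "g x (C, D) = 0" "g y (C, D) = 1"
      unfolding g_def by auto
    then show False using xy by simp
  qed
  ultimately have "embedding_map X P g"
    using continuous_imp_embedding_map assms(1) by blast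
  then have "X homeomorphic_space subtopology P (g ` topspace X)"
    by (rule embedding_map_imp_homeomorphic_space)
  then show ?thesis
    using homeomorphic_metrizable_space metrizable_space_subtopology mP by blast
qed

text \<open>A sequence of compact sets whose interiors form a base of the topology. It serves both as a
  countable base and, through its finite unions, as a compact exhaustion.\<close>

definition compact_network :: "'a topology \<Rightarrow> (nat \<Rightarrow> 'a set) \<Rightarrow> bool" where
  "compact_network Y K \<longleftrightarrow> (\<forall>i. compactin Y (K i)) \<and>
     (\<forall>U y. openin Y U \<and> y \<in> U \<longrightarrow> (\<exists>i. y \<in> Y interior_of K i \<and> K i \<subseteq> U))"

lemma compact_networkD:
  assumes "compact_network Y K"
  shows "compactin Y (K i)"
    and "\<lbrakk>openin Y U; y \<in> U\<rbrakk> \<Longrightarrow> \<exists>i. y \<in> Y interior_of K i \<and> K i \<subseteq> U"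
  using assms unfolding compact_network_def by blast+

lemma standard_space_has_compact_network:
  assumes "standard_space Y"
  obtains K where "compact_network Y K"
proof -
  have Y: "metrizable_space Y" "locally_compact_space Y" "second_countable Y" "Hausdorff_space Y"
    using assms separable_metrizable_imp_second_countable metrizable_imp_Hausdorff_space
    unfolding standard_space_def by auto
  obtain \<B> where \<B>: "countable \<B>" "\<And>V. V \<in> \<B> \<Longrightarrow> openin Y V"
    "\<And>U x. \<lbrakk>openin Y U; x \<in> U\<rbrakk> \<Longrightarrow> \<exists>V\<in>\<B>. x \<in> V \<and> V \<subseteq> U"
    using Y(3) unfolding second_countable_def by metis
  define \<K> where "\<K> = insert {} {Y closure_of V | V. V \<in> \<B> \<and> compactin Y (Y closure_of V)}"
  have "\<K> \<subseteq> insert {} ((\<lambda>V. Y closure_of V) ` \<B>)" unfolding \<K>_def by auto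
  then have "countable \<K>" using \<B>(1) by (meson countable_image countable_insert countable_subset)
  moreover have "\<K> \<noteq> {}" unfolding \<K>_def by blast
  ultimately obtain K :: "nat \<Rightarrow> 'a set" where K: "range K = \<K>"
    using range_from_nat_into by metis
  have comp: "compactin Y (K i)" for i
  proof -
    have "K i \<in> \<K>" using K by blast
    then show ?thesis unfolding \<K>_def by auto
  qed
  have net: "\<exists>i. y \<in> Y interior_of K i \<and> K i \<subseteq> U" if U: "openin Y U" "y \<in> U" for U y
  proof -
    have "neighbourhood_base_of (\<lambda>C. compactin Y C \<and> closedin Y C) Y"
      using Y locally_compact_space_neighbourhood_base_closedin by blast
    then obtain W C where WC: "openin Y W" "compactin Y C" "closedin Y C" "y \<in> W" "W \<subseteq> C" "C \<subseteq> U"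
      using U unfolding neighbourhood_base_of by metis
    obtain V where V: "V \<in> \<B>" "y \<in> V" "V \<subseteq> W"
      using \<B>(3)[OF WC(1,4)] by blast
    have cl: "Y closure_of V \<subseteq> C"
      using V WC by (meson closure_of_minimal order_trans)
    then have "compactin Y (Y closure_of V)"
      using WC(2) closed_compactin closedin_closure_of by blast
    then have "Y closure_of V \<in> \<K>" using V unfolding \<K>_def by blast
    then obtain i where i: "K i = Y closure_of V" using K by blast
    have "V \<subseteq> Y interior_of K i"
      unfolding i using \<B>(2)[OF V(1)] by (simp add: closure_of_subset interior_of_maximal openin_subset)
    then show ?thesis using i cl WC(6) V(2) by (intro exI[of _ i]) (simp add: subset_iff)
  qed
  show ?thesis
    using comp net by (intro that[of K]) (simp add: compact_network_def)
qed

section \<open>Copies of standard spaces on the real line\<close>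

lemma standard_space_homeomorphic:
  "\<lbrakk>X homeomorphic_space Y; standard_space X\<rbrakk> \<Longrightarrow> standard_space Y"
  unfolding standard_space_def
  using homeomorphic_metrizable_space homeomorphic_locally_compact_space homeomorphic_separable_space
  by blast

text \<open>A compact network \<open>K\<close> separates points, so \<open>z\<close> is encoded by the set of indices \<open>i\<close>
  with \<open>z \<in> K i\<close>, and sets of natural numbers embed into the reals.\<close>

lemma standard_space_real_copy:
  assumes "standard_space Z"
  obtains Z' :: "real topology" and h where "standard_space Z'" "homeomorphic_map Z' Z h"
proof -
  have H: "Hausdorff_space Z"
    using assms metrizable_imp_Hausdorff_space unfolding standard_space_def by auto
  obtain K where K: "compact_network Z K"
    using assms standard_space_has_compact_network by blast
  obtain e :: "nat set \<Rightarrow> real" where e: "inj e"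
    using nat_sets_eqpoll_reals unfolding eqpoll_def bij_betw_def by blast
  define f where "f z = e {i. z \<in> K i}" for z
  have f: "inj_on f (topspace Z)"
  proof (rule inj_onI, rule ccontr)
    fix x y assume xy: "x \<in> topspace Z" "y \<in> topspace Z" "f x = f y" "x \<noteq> y"
    have "openin Z (topspace Z - {y})"
      using H xy by (meson closedin_Hausdorff_singleton openin_diff openin_topspace)
    then obtain i where "x \<in> Z interior_of K i" "K i \<subseteq> topspace Z - {y}"
      using compact_networkD(2)[OF K] xy by (metis DiffI singletonD)
    then have "x \<in> K i" "y \<notin> K i" using interior_of_subset by fastforce+
    then show False using xy(3) e unfolding f_def inj_def by blast
  qed
  define g where "g = inv_into (topspace Z) f"
  define Z' where "Z' = pullback_topology (f ` topspace Z) g Z"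
  have gf: "g (f z) = z" if "z \<in> topspace Z" for z
    using that f unfolding g_def by simp
  have top: "topspace Z' = f ` topspace Z"
    unfolding Z'_def topspace_pullback_topology using gf by auto
  have h: "homeomorphic_map Z' Z g"
  proof (rule bijective_open_imp_homeomorphic_map)
    show "continuous_map Z' Z g"
      unfolding continuous_map_alt
    proof (intro conjI allI impI)
      fix U assume "openin Z U"
      then show "openin Z' (g -` U \<inter> topspace Z')"
        unfolding top unfolding Z'_def openin_pullback_topology by (intro exI[of _ U]) simp
    qed (auto simp: top gf)
    show "open_map Z' Z g"
      unfolding open_map_def
    proof (intro allI impI)
      fix S assume "openin Z' S"
      then obtain U where U: "openin Z U" "S = g -` U \<inter> f ` topspace Z"
        unfolding Z'_def openin_pullback_topology by blast
      have "g ` S = U"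
      proof
        show "U \<subseteq> g ` S"
        proof
          fix u assume "u \<in> U"
          then show "u \<in> g ` S"
            using U openin_subset[OF U(1)] gf[of u] by (intro image_eqI[of _ _ "f u"]) auto
        qed
      qed (use U in auto)
      then show "openin Z (g ` S)" using U by simp
    qed
    show "g ` topspace Z' = topspace Z"
      unfolding top using gf by force
    show "inj_on g (topspace Z')"
      unfolding top by (rule inj_onI) (auto simp: gf)
  qed
  then have "standard_space Z'"
    using assms standard_space_homeomorphic homeomorphic_map_imp_homeomorphic_space
      homeomorphic_space_sym by blast
  then show ?thesis using that h by blast
qed

section \<open>Sequences\<close>

lemma seq_inD:
  assumes "seq_in X S s x"
  shows "s n \<in> S" and "limitin X s x sequentially" and "x \<in> topspace X"
  using assms limitin_topspace[of X s x sequentially] unfolding seq_in_def by auto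

lemma seq_in_mono: "\<lbrakk>seq_in X S s x; S \<subseteq> T\<rbrakk> \<Longrightarrow> seq_in X T s x"
  unfolding seq_in_def by blast

lemma seq_in_subseq:
  assumes "seq_in X S s x" "strict_mono r"
  shows "seq_in X S (s \<circ> r) x"
  using assms limitin_subsequence unfolding seq_in_def by fastforce

lemma seq_in_closure_of:
  assumes "seq_in X S s x"
  shows "x \<in> X closure_of S"
  unfolding in_closure_of
proof (intro conjI allI impI)
  show "x \<in> topspace X" using assms seq_inD by metis
  fix U assume U: "x \<in> U \<and> openin X U"
  then have "eventually (\<lambda>n. s n \<in> U) sequentially"
    using assms limitinD seq_inD(2) by metis
  then obtain n where "s n \<in> U"
    using eventually_happens'[OF trivial_limit_sequentially] by blast
  then show "\<exists>y. y \<in> S \<and> y \<in> U" using assms seq_inD by metis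
qed

text \<open>The usual way to refute that a convergent sequence is eventually in \<open>A\<close>.\<close>

lemma seq_in_frequently_subseq:
  assumes "seq_in X S s x" "\<not> eventually (\<lambda>n. s n \<in> A) sequentially"
  obtains r where "strict_mono (r :: nat \<Rightarrow> nat)" "seq_in X (S - A) (s \<circ> r) x"
proof -
  have "infinite {n. s n \<notin> A}"
    using assms(2) unfolding cofinite_eq_sequentially[symmetric] eventually_cofinite by simp
  then obtain r :: "nat \<Rightarrow> nat" where r: "strict_mono r" "\<And>n. r n \<in> {n. s n \<notin> A}"
    using infinite_enumerate by blast
  then have "seq_in X (S - A) (s \<circ> r) x"
    using seq_in_subseq[OF assms(1) r(1)] unfolding seq_in_def by auto
  then show ?thesis using that r(1) by blast
qed

lemma unbounded_imp_strict_mono_subseq: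
  fixes l :: "nat \<Rightarrow> nat"
  assumes "\<And>N. \<exists>m. N < l m"
  obtains r where "strict_mono (r :: nat \<Rightarrow> nat)" "strict_mono (l \<circ> r)"
proof -
  have "\<exists>m'. m < m' \<and> l m < l m'" for m
  proof -
    obtain m' where m': "Max (l ` {..m}) < l m'" using assms by blast
    then have "l i < l m'" if "i \<le> m" for i
      using that by (meson Max_ge atMost_iff finite_atMost finite_imageI image_eqI le_less_trans)
    then show ?thesis by (metis le_refl less_irrefl linorder_not_less)
  qed
  then obtain r where "\<And>n. r n < r (Suc n) \<and> l (r n) < l (r (Suc n))"
    using dependent_nat_choice[of "\<lambda>_ _. True" "\<lambda>_ m m'. m < m' \<and> l m < l m'"] by auto
  then show ?thesis using that[of r] by (simp add: strict_mono_Suc_iff)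
qed

lemma infinite_range_imp_inj_subseq:
  fixes x :: "nat \<Rightarrow> 'a"
  assumes "infinite (range x)"
  obtains i where "strict_mono (i :: nat \<Rightarrow> nat)" "inj (x \<circ> i)"
proof -
  define f where "f y = (LEAST n. x n = y)" for y
  have xf: "x (f y) = y" if "y \<in> range x" for y
    unfolding f_def using that by (metis (mono_tags, lifting) LeastI rangeE)
  then have "inj_on f (range x)" by (metis inj_onI)
  then have "infinite (f ` range x)" using assms finite_imageD by blast
  then obtain i where i: "strict_mono (i :: nat \<Rightarrow> nat)" "\<And>n. i n \<in> f ` range x"
    using infinite_enumerate by blast
  have "f (x (i n)) = i n" for n using i(2)[of n] xf by auto
  then have "inj (x \<circ> i)"
    using strict_mono_imp_inj_on[OF i(1)] by (metis (mono_tags, lifting) comp_apply injD injI)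
  then show ?thesis using that i(1) by blast
qed

section \<open>Unions of compact stages and their sequential interiors\<close>

text \<open>A Hausdorff space that is the direct limit of an increasing sequence of compact subsets. The
  sets \<open>C n\<close> are the stages; \<open>X\<close> may fail to be locally compact or first countable.\<close>

locale k_omega_space =
  fixes X :: "'a topology" and C :: "nat \<Rightarrow> 'a set"
  assumes Hausdorff: "Hausdorff_space X"
    and compact_stage: "compactin X (C n)"
    and stage_Suc: "C n \<subseteq> C (Suc n)"
    and cover: "topspace X \<subseteq> (\<Union>n. C n)"
    and closed_if_closed_in_stages:
      "\<lbrakk>A \<subseteq> topspace X; \<And>n. closedin X (A \<inter> C n)\<rbrakk> \<Longrightarrow> closedin X A"
begin

lemma stage_mono: "m \<le> n \<Longrightarrow> C m \<subseteq> C n"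
  by (rule lift_Suc_mono_le[of C, OF stage_Suc])

lemma stage_subset: "C n \<subseteq> topspace X"
  using compact_stage compactin_subset_topspace by blast

lemma closed_stage: "closedin X (C n)"
  using compactin_imp_closedin Hausdorff compact_stage by blast

text \<open>Otherwise one could pick \<open>x n \<in> K - C n\<close> for every \<open>n\<close>. Each stage meets the range of \<open>x\<close> in a
  finite set, so the range and all its subsets are closed: an infinite closed discrete subset
  of a compact set.\<close>

lemma compact_subset_stage:
  assumes "compactin X K"
  obtains n where "K \<subseteq> C n"
proof (rule ccontr)
  assume "\<not> thesis"
  then have "\<not> K \<subseteq> C n" for n using that[of n] by blast
  then have "\<forall>n. \<exists>x. x \<in> K - C n" by blast
  then obtain x where x: "\<And>n. x n \<in> K - C n" by metis
  have K: "K \<subseteq> topspace X" using assms compactin_subset_topspace by blast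
  have fin: "finite (range x \<inter> C n)" for n
  proof -
    have "range x \<inter> C n \<subseteq> x ` {..<n}"
    proof
      fix y assume "y \<in> range x \<inter> C n"
      then obtain m where m: "y = x m" "x m \<in> C n" by blast
      then have "\<not> n \<le> m" using x[of m] stage_mono by blast
      then show "y \<in> x ` {..<n}" using m by simp
    qed
    then show ?thesis by (meson finite_imageI finite_lessThan finite_subset)
  qed
  have cl: "closedin X B" if B: "B \<subseteq> range x" for B
  proof (rule closed_if_closed_in_stages)
    show "B \<subseteq> topspace X" using B x K by blast
    fix n
    have "finite (B \<inter> C n)" using fin[of n] B by (meson Int_mono finite_subset order_refl)
    moreover have "B \<inter> C n \<subseteq> topspace X" using stage_subset by blast
    ultimately show "closedin X (B \<inter> C n)"
      using finite_imp_compactin compactin_imp_closedin Hausdorff by metis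
  qed
  have "infinite (range x)"
  proof
    assume f: "finite (range x)"
    have "\<forall>y\<in>range x. \<exists>n. y \<in> C n" using x K cover by blast
    then obtain m where m: "\<And>y. y \<in> range x \<Longrightarrow> y \<in> C (m y)" by metis
    define M where "M = Max (m ` range x)"
    have "x M \<in> C (m (x M))" using m by blast
    moreover have "m (x M) \<le> M" unfolding M_def using f by simp
    ultimately show False using x[of M] stage_mono by blast
  qed
  then obtain p where "p \<in> X derived_set_of range x"
    using compactin_imp_Bolzano_Weierstrass[OF assms, of "range x"] x by blast
  then have "p \<in> X closure_of (range x - {p})"
    unfolding in_closure_of in_derived_set_of by blast
  moreover have "X closure_of (range x - {p}) = range x - {p}"
    using cl closure_of_closedin by blast
  ultimately show False by blast
qed

lemma convergent_sequence_in_stage: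
  assumes "seq_in X (topspace X) s x"
  obtains n where "range s \<subseteq> C n" "x \<in> C n"
proof -
  have "compactin X (insert x (range s))"
    using assms by (intro compactin_sequence_with_limit) (auto simp: seq_in_def)
  then show ?thesis using compact_subset_stage that by (metis insert_subset)
qed

text \<open>The sequential interior of the stage \<open>C n\<close>: a point is excluded when it is a limit of points of
  some stage outside \<open>C n\<close>. In this form it is visibly a \<open>G\<^sub>\<delta>\<close> set. It can be larger
  than the topological interior.\<close>

definition inner_stage :: "nat \<Rightarrow> 'a set" where
  "inner_stage n = topspace X - (\<Union>k. X closure_of (C k - C n))"

lemma not_inner_stage: "x \<in> topspace X \<Longrightarrow> x \<notin> inner_stage n \<longleftrightarrow> (\<exists>k. x \<in> X closure_of (C k - C n))"
  unfolding inner_stage_def by blast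

lemma inner_stage_subset: "inner_stage n \<subseteq> C n"
proof
  fix x assume x: "x \<in> inner_stage n"
  then obtain k where "x \<in> C k" "x \<in> topspace X" unfolding inner_stage_def using cover by blast
  then show "x \<in> C n"
    using x stage_subset[of k] closure_of_subset[of "C k - C n" X] unfolding inner_stage_def by blast
qed

lemma inner_stage_mono:
  assumes "m \<le> n" shows "inner_stage m \<subseteq> inner_stage n"
proof -
  have "X closure_of (C k - C n) \<subseteq> X closure_of (C k - C m)" for k
    using stage_mono[OF assms] by (intro closure_of_mono) blast
  then show ?thesis unfolding inner_stage_def by blast
qed

text \<open>A point of \<open>inner_stage k\<close> that is a limit of points outside \<open>C n\<close> is a limit of
  points of \<open>C k\<close> outside \<open>C n\<close>, since nothing outside \<open>C k\<close> clusters at it within a stage.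
  As the right-hand side is closed and misses \<open>inner_stage n\<close>, the set \<open>inner_stage n\<close> is relatively
  open in \<open>inner_stage k\<close> when \<open>n \<le> k\<close>.\<close>

lemma inner_stage_diff_subset:
  "inner_stage k - inner_stage n \<subseteq> X closure_of (C k - C n)"
proof
  fix x assume x: "x \<in> inner_stage k - inner_stage n"
  then obtain j where j: "x \<in> X closure_of (C j - C n)"
    unfolding inner_stage_def by blast
  have "X closure_of (C j - C n) \<subseteq> X closure_of ((C j - C k) \<union> (C k - C n))"
    by (intro closure_of_mono) blast
  with j x show "x \<in> X closure_of (C k - C n)"
    unfolding closure_of_Un inner_stage_def by blast
qed

lemma inner_stage_eventually:
  assumes "x \<in> inner_stage n" "seq_in X (topspace X) s x"
  shows "eventually (\<lambda>i. s i \<in> C n) sequentially"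
proof (rule ccontr)
  assume "\<not> ?thesis"
  then obtain r where r: "strict_mono r" "seq_in X (topspace X - C n) (s \<circ> r) x"
    using seq_in_frequently_subseq[OF assms(2)] by blast
  then obtain k where "range (s \<circ> r) \<subseteq> C k"
    using convergent_sequence_in_stage[OF seq_in_mono[OF r(2) Diff_subset]] by metis
  then have "seq_in X (C k - C n) (s \<circ> r) x"
    using r(2) unfolding seq_in_def by blast
  then have "x \<in> X closure_of (C k - C n)" by (rule seq_in_closure_of)
  then show False
    using assms(1) unfolding inner_stage_def by blast
qed

definition core_stage :: "nat \<Rightarrow> 'a set" where
  "core_stage n = X closure_of inner_stage n"

lemma core_stage_subset: "core_stage n \<subseteq> C n"
  unfolding core_stage_def by (simp add: closure_of_minimal inner_stage_subset closed_stage)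

lemma inner_stage_subset_core: "inner_stage n \<subseteq> core_stage n"
  unfolding core_stage_def by (rule closure_of_subset) (auto simp: inner_stage_def)

lemma core_stage_mono: "m \<le> n \<Longrightarrow> core_stage m \<subseteq> core_stage n"
  unfolding core_stage_def by (intro closure_of_mono inner_stage_mono)

lemma compact_core_stage: "compactin X (core_stage n)"
  using closed_compactin[OF compact_stage core_stage_subset] unfolding core_stage_def by simp

text \<open>The closures of the sequential interiors may replace the stages: they cover the space and
  determine its topology. This is the form in which properties (a) and (b) are used.\<close>

definition core_determined :: bool where
  "core_determined \<longleftrightarrow> topspace X \<subseteq> (\<Union>n. core_stage n) \<and>
     (\<forall>A. A \<subseteq> topspace X \<and> (\<forall>n. closedin X (A \<inter> core_stage n)) \<longrightarrow> closedin X A)"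

lemma core_determined_k_omega:
  assumes "core_determined"
  shows "k_omega_space X core_stage"
  using assms Hausdorff compact_core_stage core_stage_mono unfolding core_determined_def
  by unfold_locales auto

text \<open>Not only \<open>C n\<close> but already the smaller compact set \<open>core_stage n\<close> is a sequential neighbourhood of
  the points of \<open>inner_stage n\<close>: the stage \<open>C k\<close> lies in some \<open>core_stage m\<close>, and the points of
  \<open>core_stage m\<close> outside \<open>core_stage n\<close> are limits of points of \<open>inner_stage m\<close> outside
  \<open>inner_stage n\<close>, hence of points of \<open>C m\<close> outside \<open>C n\<close>.\<close>

lemma inner_stage_nbhd_core:
  assumes "core_determined" "x \<in> inner_stage n"
  shows "x \<notin> X closure_of (C k - core_stage n)"
proof -
  interpret core: k_omega_space X core_stage
    using assms(1) by (rule core_determined_k_omega)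
  obtain m where m: "C k \<subseteq> core_stage m"
    using core.compact_subset_stage[OF compact_stage] by blast
  have "core_stage m - core_stage n \<subseteq> X closure_of (inner_stage m - inner_stage n)"
  proof -
    have "core_stage m \<subseteq> X closure_of ((inner_stage m - inner_stage n) \<union> inner_stage n)"
      unfolding core_stage_def by (intro closure_of_mono) blast
    then show ?thesis unfolding closure_of_Un core_stage_def by blast
  qed
  also have "\<dots> \<subseteq> X closure_of (C m - C n)"
    using inner_stage_diff_subset by (simp add: closure_of_minimal)
  finally have "C k - core_stage n \<subseteq> X closure_of (C m - C n)"
    using m by blast
  then have "X closure_of (C k - core_stage n) \<subseteq> X closure_of (C m - C n)"
    by (simp add: closure_of_minimal)
  then show ?thesis
    using assms(2) unfolding inner_stage_def by blast
qed

end

text \<open>The stages are Frechet spaces, as images of compact metrizable sets are, although the whole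
  space may fail to be one.\<close>

locale sequential_k_omega_space = k_omega_space +
  assumes Frechet: "\<lbrakk>S \<subseteq> C n; x \<in> X closure_of S\<rbrakk> \<Longrightarrow> \<exists>s. seq_in X S s x"
begin

lemma sequentially_closed_imp_closed:
  assumes "A \<subseteq> topspace X" "\<And>s x. seq_in X A s x \<Longrightarrow> x \<in> A"
  shows "closedin X A"
proof (rule closed_if_closed_in_stages[OF assms(1)])
  fix n
  have "X closure_of (A \<inter> C n) \<subseteq> A \<inter> C n"
  proof
    fix x assume x: "x \<in> X closure_of (A \<inter> C n)"
    then obtain s where "seq_in X (A \<inter> C n) s x" using Frechet by (meson Int_lower2)
    then have "x \<in> A" using assms(2) seq_in_mono by (metis Int_lower1)
    moreover have "x \<in> C n"
      using x closure_of_minimal[OF Int_lower2 closed_stage] by blast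
    ultimately show "x \<in> A \<inter> C n" by blast
  qed
  then show "closedin X (A \<inter> C n)"
    using assms(1) closure_of_subset_eq by (metis Int_lower1 order_trans)
qed

lemma not_inner_stage_sequence:
  assumes "x \<in> topspace X" "x \<notin> inner_stage n"
  obtains s where "seq_in X (topspace X - C n) s x"
proof -
  obtain k where "x \<in> X closure_of (C k - C n)" using not_inner_stage[OF assms(1)] assms(2) by blast
  then obtain s where "seq_in X (C k - C n) s x" using Frechet by (meson Diff_subset)
  then show ?thesis using that seq_in_mono stage_subset by (metis Diff_mono order_refl)
qed

lemma compact_type_point_iff_inner_stage: "compact_type_point X x \<longleftrightarrow> (\<exists>n. x \<in> inner_stage n)"
proof
  assume x: "compact_type_point X x"
  then obtain K where K: "compactin X K"
      "\<And>s. seq_in X (topspace X) s x \<Longrightarrow> eventually (\<lambda>n. s n \<in> K) sequentially"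
    unfolding compact_type_point_def by blast
  obtain n where n: "K \<subseteq> C n" using K(1) compact_subset_stage by blast
  have "x \<in> inner_stage n"
  proof (rule ccontr)
    assume "x \<notin> inner_stage n"
    then obtain s where s: "seq_in X (topspace X - C n) s x"
      using not_inner_stage_sequence x unfolding compact_type_point_def by blast
    then have "eventually (\<lambda>n. s n \<in> K) sequentially" using K(2) seq_in_mono Diff_subset by metis
    then obtain i where "s i \<in> K"
      using eventually_happens'[OF trivial_limit_sequentially] by blast
    then show False using s n seq_inD(1) by (metis DiffD2 subsetD)
  qed
  then show "\<exists>n. x \<in> inner_stage n" ..
next
  assume "\<exists>n. x \<in> inner_stage n"
  then show "compact_type_point X x"
    using inner_stage_eventually compact_stage inner_stage_subset stage_subset
    unfolding compact_type_point_def by blast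
qed

text \<open>If no \<open>inner_stage n\<close> contained the sequence, a subsequence would consist of distinct points
  whose levels (the least \<open>n\<close> with \<open>x \<in> inner_stage n\<close>) strictly increase. Then each of its terms
  after the first is the limit of a sequence that avoids a stage, with the avoided stages growing
  beyond every bound, and no choice of tails of these sequences fits into a compact set.\<close>

lemma property_a_imp_sequence_in_inner_stage:
  assumes E: "E \<subseteq> topspace X" "\<And>x. x \<in> E \<Longrightarrow> compact_type_point X x" and a: "property_a X E"
    and e: "seq_in X E e x0"
  obtains n where "range e \<subseteq> inner_stage n"
proof (rule ccontr)
  assume "\<not> thesis"
  then have "\<not> range e \<subseteq> inner_stage n" for n using that[of n] by blast
  then have unb: "\<And>n. \<exists>m. e m \<notin> inner_stage n" by blast
  have "\<exists>n. e m \<in> inner_stage n" for m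
    using e E(2) seq_inD(1) compact_type_point_iff_inner_stage by metis
  then have in_lev: "x \<in> inner_stage (LEAST n. x \<in> inner_stage n)" if "x \<in> range e" for x
    using that by (metis (mono_tags, lifting) LeastI_ex rangeE)
  define lev where "lev x = (LEAST n. x \<in> inner_stage n)" for x
  have "\<exists>m. n < lev (e m)" for n
    using unb[of n] in_lev inner_stage_mono unfolding lev_def
    by (metis linorder_not_less rangeI subsetD)
  then obtain r :: "nat \<Rightarrow> nat" where r: "strict_mono r" "strict_mono ((\<lambda>m. lev (e m)) \<circ> r)"
    by (rule unbounded_imp_strict_mono_subseq)
  define f where "f = e \<circ> r"
  have f: "seq_in X E f x0" unfolding f_def using seq_in_subseq[OF e r(1)] .
  have levf: "strict_mono (\<lambda>i. lev (f i))" using r(2) unfolding f_def comp_def .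
  have "inj f"
    using levf strict_mono_eq by (metis (mono_tags, lifting) injI)
  then obtain r' where r': "strict_mono (r' :: nat \<Rightarrow> nat)"
    and cpt: "\<And>s :: nat \<Rightarrow> nat \<Rightarrow> 'a. (\<And>n. seq_in X (topspace X) (s n) (f (r' n))) \<Longrightarrow>
        \<exists>k :: nat \<Rightarrow> nat. compactin X (X closure_of {s n j | n j. k n \<le> j})"
    using a f unfolding property_a_def by meson
  have ftop: "f n \<in> topspace X" for n using f E(1) seq_inD(1) by (metis subsetD)
  have "\<exists>s. seq_in X (topspace X - C n) s (f (r' (Suc n)))" for n
  proof -
    have "n < lev (f (r' (Suc n)))"
    proof -
      have "Suc n \<le> r' (Suc n)" using r' strict_mono_imp_increasing by blast
      also have "\<dots> \<le> lev (f (r' (Suc n)))" using levf strict_mono_imp_increasing by blast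
      finally show ?thesis by simp
    qed
    then have "f (r' (Suc n)) \<notin> inner_stage n"
      unfolding lev_def using not_less_Least by blast
    then show ?thesis using not_inner_stage_sequence[OF ftop] by metis
  qed
  then obtain t where t: "\<And>n. seq_in X (topspace X - C n) (t n) (f (r' (Suc n)))" by metis
  \<comment> \<open>The term with index \<open>0\<close> may have level \<open>0\<close>, so a constant sequence has to serve there.\<close>
  define s where "s n = (case n of 0 \<Rightarrow> (\<lambda>_. f (r' 0)) | Suc m \<Rightarrow> t m)" for n
  have "seq_in X (topspace X) (s n) (f (r' n))" for n
  proof (cases n)
    case 0
    then show ?thesis unfolding s_def seq_in_def using ftop by auto
  next
    case (Suc m)
    then show ?thesis unfolding s_def using seq_in_mono[OF t] by simp
  qed
  then obtain k where k: "compactin X (X closure_of {s n j | n j. k n \<le> j})"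
    using cpt by blast
  then obtain N where N: "X closure_of {s n j | n j. k n \<le> j} \<subseteq> C N"
    using compact_subset_stage by blast
  have tN: "t N (k (Suc N)) \<in> topspace X - C N"
    using seq_inD(1)[OF t] .
  have "t N (k (Suc N)) \<in> {s n j | n j. k n \<le> j}"
  proof -
    have "t N (k (Suc N)) = s (Suc N) (k (Suc N))" by (simp add: s_def)
    then show ?thesis by blast
  qed
  then have "t N (k (Suc N)) \<in> X closure_of {s n j | n j. k n \<le> j}"
    using closure_of_subset_Int[of X] tN by (meson DiffD1 IntI subsetD)
  then have "t N (k (Suc N)) \<in> C N" using N by (rule rev_subsetD)
  then show False using tN by simp
qed

text \<open>Let \<open>y\<close> be a convergent sequence of distinct points and \<open>s\<close> the double sequence in \<open>E\<close> from
  property (b). Each row of \<open>s\<close> converges and thus lies in one \<open>inner_stage M\<close>, and the bound \<open>M\<close> can be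
  chosen for all rows at once: a diagonal consisting of terms of maximal level converges too.
  Hence a subsequence of \<open>y\<close> lies in a single \<open>core_stage M\<close>, and sets whose traces on all core stages
  are closed are sequentially closed.\<close>

lemma properties_imp_core_determined:
  assumes sd: "sequentially_dense X E" and ct: "\<And>x. x \<in> E \<Longrightarrow> compact_type_point X x"
    and a: "property_a X E" and b: "property_b X E"
  shows "core_determined"
proof -
  have E: "E \<subseteq> topspace X" using sd unfolding sequentially_dense_def by blast
  have in_inner: "\<exists>n. range e \<subseteq> inner_stage n" if "seq_in X E e x0" for e x0
    using property_a_imp_sequence_in_inner_stage[OF E _ a that] ct by metis
  have lim_in_core: "\<exists>n. x \<in> core_stage n" if e: "seq_in X E e x" for e x
  proof -
    obtain n where "range e \<subseteq> inner_stage n" using in_inner[OF e] by blast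
    then have "seq_in X (inner_stage n) e x" using e unfolding seq_in_def by blast
    then show ?thesis unfolding core_stage_def using seq_in_closure_of by metis
  qed
  have cov: "topspace X \<subseteq> (\<Union>n. core_stage n)"
  proof
    fix x assume "x \<in> topspace X"
    then obtain e where "seq_in X E e x" using sd unfolding sequentially_dense_def by metis
    then show "x \<in> (\<Union>n. core_stage n)" using lim_in_core by simp
  qed
  have "closedin X A" if A: "A \<subseteq> topspace X" "\<And>n. closedin X (A \<inter> core_stage n)" for A
  proof (rule sequentially_closed_imp_closed[OF A(1)])
    fix x x0 assume x: "seq_in X A x x0"
    show "x0 \<in> A"
    proof (cases "finite (range x)")
      case True
      have "range x \<subseteq> A" using x unfolding seq_in_def by blast
      then have "compactin X (range x)"
        using True A(1) finite_imp_compactin by (metis order_trans)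
      then have "closedin X (range x)" using Hausdorff compactin_imp_closedin by blast
      then have "X closure_of range x = range x" by (simp add: closure_of_eq)
      moreover have "seq_in X (range x) x x0" using x unfolding seq_in_def by blast
      ultimately have "x0 \<in> range x" using seq_in_closure_of by metis
      then show ?thesis using \<open>range x \<subseteq> A\<close> by (rule rev_subsetD)
    next
      case False
      then obtain i where i: "strict_mono (i :: nat \<Rightarrow> nat)" "inj (x \<circ> i)"
        using infinite_range_imp_inj_subseq by blast
      define y where "y = x \<circ> i"
      have y: "seq_in X A y x0" unfolding y_def using seq_in_subseq[OF x i(1)] .
      then obtain r s where r: "strict_mono (r :: nat \<Rightarrow> nat)"
        and s: "\<And>n. seq_in X E (s n :: nat \<Rightarrow> 'a) (y (r n))"
        and diag: "\<And>j :: nat \<Rightarrow> nat. limitin X (\<lambda>n. s n (j n)) x0 sequentially"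
        using b i(2) seq_in_mono[OF y A(1)] unfolding property_b_def y_def[symmetric] by meson
      have "\<exists>M. range (s n) \<subseteq> inner_stage M" for n
        using in_inner[OF s] by blast
      then have rowL: "range (s n) \<subseteq> inner_stage (LEAST M. range (s n) \<subseteq> inner_stage M)" for n
        by (rule LeastI_ex)
      \<comment> \<open>The level of the \<open>n\<close>-th row; below, \<open>j n\<close> picks a term that attains it.\<close>
      define L where "L n = (LEAST M. range (s n) \<subseteq> inner_stage M)" for n
      have "\<exists>j. L n > 0 \<longrightarrow> s n j \<notin> inner_stage (L n - 1)" for n
      proof (cases "L n > 0")
        case True
        then have "\<not> range (s n) \<subseteq> inner_stage (L n - 1)"
          unfolding L_def by (intro not_less_Least) simp
        then show ?thesis by blast
      qed auto
      then obtain j where j: "\<And>n. L n > 0 \<Longrightarrow> s n (j n) \<notin> inner_stage (L n - 1)" by metis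
      have "seq_in X E (\<lambda>n. s n (j n)) x0"
        unfolding seq_in_def using diag seq_inD(1)[OF s] by blast
      then obtain M where M: "range (\<lambda>n. s n (j n)) \<subseteq> inner_stage M" using in_inner by blast
      have LM: "L n \<le> M" for n
      proof (rule ccontr)
        assume "\<not> L n \<le> M"
        then have "inner_stage M \<subseteq> inner_stage (L n - 1)" by (intro inner_stage_mono) simp
        moreover have "s n (j n) \<in> inner_stage M" using M by blast
        ultimately show False using j[of n] \<open>\<not> L n \<le> M\<close> by auto
      qed
      have "y (r n) \<in> core_stage M" for n
      proof -
        have "range (s n) \<subseteq> inner_stage M"
          using rowL[of n] inner_stage_mono[OF LM[of n]] unfolding L_def by blast
        then have "seq_in X (inner_stage M) (s n) (y (r n))"
          using s[of n] unfolding seq_in_def by blast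
        then show ?thesis unfolding core_stage_def using seq_in_closure_of by metis
      qed
      then have "seq_in X (A \<inter> core_stage M) (y \<circ> r) x0"
        using seq_in_subseq[OF y r] unfolding seq_in_def by auto
      then show ?thesis
        using seq_in_closure_of A(2)[of M] closure_of_closedin by (metis IntD1)
    qed
  qed
  with cov show ?thesis unfolding core_determined_def by blast
qed

end

section \<open>The Fell topology\<close>

lemma openin_fell_miss:
  "compactin Y K \<Longrightarrow> openin (fell_topology Y) {F. closedin Y F \<and> F \<inter> K = {}}"
  unfolding fell_topology_def by (rule topology_generated_by_Basis) blast

lemma openin_fell_hit:
  "openin Y U \<Longrightarrow> openin (fell_topology Y) {F. closedin Y F \<and> F \<inter> U \<noteq> {}}"
  unfolding fell_topology_def by (rule topology_generated_by_Basis) blast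

lemma closedin_fell_hit:
  assumes "compactin Y K"
  shows "closedin (fell_topology Y) {F. closedin Y F \<and> F \<inter> K \<noteq> {}}"
proof -
  have "topspace (fell_topology Y) - {F. closedin Y F \<and> F \<inter> K \<noteq> {}} = {F. closedin Y F \<and> F \<inter> K = {}}"
    unfolding topspace_fell_topology by blast
  then show ?thesis
    unfolding closedin_def[of "fell_topology Y"] using openin_fell_miss[OF assms] by (auto simp: topspace_fell_topology)
qed

lemma closedin_fell_miss:
  assumes "openin Y U"
  shows "closedin (fell_topology Y) {F. closedin Y F \<and> F \<inter> U = {}}"
proof -
  have "topspace (fell_topology Y) - {F. closedin Y F \<and> F \<inter> U = {}} = {F. closedin Y F \<and> F \<inter> U \<noteq> {}}"
    unfolding topspace_fell_topology by blast
  then show ?thesis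
    unfolding closedin_def[of "fell_topology Y"] using openin_fell_hit[OF assms] by (auto simp: topspace_fell_topology)
qed

text \<open>The Alexander subbase theorem for topologies given by \<^const>\<open>generate_topology_on\<close>.\<close>

lemma compact_space_topology_generated_by:
  assumes "\<And>\<C>. \<lbrakk>\<C> \<subseteq> \<S>; \<Union>\<C> = \<Union>\<S>\<rbrakk> \<Longrightarrow> \<exists>\<C>'. finite \<C>' \<and> \<C>' \<subseteq> \<C> \<and> \<Union>\<C>' = \<Union>\<S>"
  shows "compact_space (topology_generated_by \<S>)"
proof (rule Alexander_subbase[of \<S>])
  let ?T = "topology (arbitrary union_of (finite intersection_of (\<lambda>x. x \<in> \<S>) relative_to \<Union>\<S>))"
  have basis: "openin ?T S" if "S \<in> \<S>" for S
  proof -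
    have "(finite intersection_of (\<lambda>x. x \<in> \<S>) relative_to \<Union>\<S>) (\<Union>\<S> \<inter> S)"
      using that by (simp add: relative_to_inc finite_intersection_of_inc)
    moreover have "\<Union>\<S> \<inter> S = S" using that by blast
    ultimately show ?thesis unfolding openin_subbase by (simp add: arbitrary_union_of_inc)
  qed
  show "?T = topology_generated_by \<S>"
    unfolding topology_eq
  proof (intro allI iffI)
    fix S assume "openin ?T S"
    then show "openin (topology_generated_by \<S>) S"
      by (rule minimal_topology_subbase[rotated 2])
        (auto simp: topology_generated_by_Basis simp flip: topology_generated_by_topspace)
  next
    fix S assume "openin (topology_generated_by \<S>) S"
    then show "openin ?T S"
      by (intro generate_topology_on_coarsest[of "openin ?T", OF istopology_openin basis])
        (simp_all add: openin_topology_generated_by_iff)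
  qed
qed (use assms in simp)

text \<open>Given a subbasic cover, let \<open>F0\<close> be the complement of the union of all open sets whose hit sets
  occur in it. The member that contains \<open>F0\<close> can only be a miss set of a compact \<open>K\<close>. These open
  sets then cover \<open>K\<close>; a finite subcover of \<open>K\<close> together with the miss set of \<open>K\<close> covers everything.\<close>

lemma compact_space_fell: "compact_space (fell_topology Y)"
  unfolding fell_topology_def
proof (rule compact_space_topology_generated_by)
  let ?miss = "\<lambda>K. {F. closedin Y F \<and> F \<inter> K = {}}" and ?hit = "\<lambda>U. {F. closedin Y F \<and> F \<inter> U \<noteq> {}}"
  let ?S = "{?miss K | K. compactin Y K} \<union> {?hit U | U. openin Y U}"
  have un: "\<Union>?S = {F. closedin Y F}"
    using topspace_fell_topology[of Y] unfolding fell_topology_def by simp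
  fix \<C> assume \<C>: "\<C> \<subseteq> ?S" "\<Union>\<C> = \<Union>?S"
  define \<U> where "\<U> = {U. openin Y U \<and> ?hit U \<in> \<C>}"
  define F0 where "F0 = topspace Y - \<Union>\<U>"
  have "closedin Y F0"
    unfolding F0_def \<U>_def by (intro closedin_diff) auto
  then have "F0 \<in> \<Union>\<C>" using \<C>(2) un by simp
  then obtain S where S: "S \<in> \<C>" "F0 \<in> S" by blast
  have not_hit: "\<not> (\<exists>U. openin Y U \<and> S = ?hit U)"
  proof
    assume "\<exists>U. openin Y U \<and> S = ?hit U"
    then obtain U where "openin Y U" "S = ?hit U" by metis
    then have "U \<in> \<U>" "F0 \<inter> U \<noteq> {}" using S unfolding \<U>_def by simp_all
    then show False unfolding F0_def by blast
  qed
  have "S \<in> ?S" using S(1) \<C>(1) by (rule rev_subsetD)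
  then have "\<exists>K. compactin Y K \<and> S = ?miss K"
  proof (elim UnE CollectE exE conjE)
    fix K assume "S = ?miss K" "compactin Y K"
    then show ?thesis by (intro exI[of _ K] conjI)
  next
    fix U assume "S = ?hit U" "openin Y U"
    then have "\<exists>U. openin Y U \<and> S = ?hit U" by (intro exI[of _ U] conjI)
    then show ?thesis by (rule notE[OF not_hit])
  qed
  then obtain K where K: "compactin Y K" "S = ?miss K" by (elim exE conjE)
  have "K \<subseteq> \<Union>\<U>"
    using S(2) K compactin_subset_topspace[OF K(1)] unfolding F0_def by auto
  then obtain \<U>' where \<U>': "finite \<U>'" "\<U>' \<subseteq> \<U>" "K \<subseteq> \<Union>\<U>'"
    using K(1) unfolding compactin_def \<U>_def by (metis (no_types, lifting) mem_Collect_eq)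
  have "{F. closedin Y F} \<subseteq> \<Union>(insert S (?hit ` \<U>'))"
  proof
    fix F assume F: "F \<in> {F. closedin Y F}"
    show "F \<in> \<Union>(insert S (?hit ` \<U>'))"
    proof (cases "F \<inter> K = {}")
      case True then show ?thesis using F K(2) by simp
    next
      case False
      then obtain U where "U \<in> \<U>'" "F \<inter> U \<noteq> {}" using \<U>'(3) by blast
      then show ?thesis using F by auto
    qed
  qed
  moreover have sub: "insert S (?hit ` \<U>') \<subseteq> \<C>"
    using S(1) \<U>'(2) unfolding \<U>_def by blast
  ultimately have "\<Union>(insert S (?hit ` \<U>')) = \<Union>?S"
    using un \<C>(2) Union_mono[OF sub] by (intro equalityI) simp_all
  then show "\<exists>\<C>'. finite \<C>' \<and> \<C>' \<subseteq> \<C> \<and> \<Union>\<C>' = \<Union>?S"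
    using sub \<U>'(1) by (intro exI[of _ "insert S (?hit ` \<U>')"]) simp
qed

text \<open>The two nested network sets separate \<open>F\<close> from \<open>F'\<close> in two ways: by a hit set and a miss set that
  are both open, and by a hit set and a miss set that are both closed.\<close>

lemma fell_separation:
  assumes K: "compact_network Y K"
    and F: "closedin Y F" "closedin Y F'" "y \<in> F" "y \<notin> F'"
  obtains i j where "K j \<subseteq> Y interior_of K i" "F \<inter> Y interior_of K j \<noteq> {}" "F' \<inter> K i = {}"
proof -
  have y: "y \<in> topspace Y - F'" using F closedin_subset by blast
  have "openin Y (topspace Y - F')" using F(2) by blast
  then obtain i where i: "y \<in> Y interior_of K i" "K i \<subseteq> topspace Y - F'"
    using compact_networkD(2)[OF K] y by metis
  then obtain j where j: "y \<in> Y interior_of K j" "K j \<subseteq> Y interior_of K i"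
    using compact_networkD(2)[OF K openin_interior_of i(1)] by blast
  show ?thesis using that[of j i] i j F(3) by blast
qed

lemma compact_network_fell_metrizable:
  assumes K: "compact_network Y K"
  shows "Hausdorff_space (fell_topology Y)" and "metrizable_space (fell_topology Y)"
proof -
  let ?miss = "\<lambda>K. {F. closedin Y F \<and> F \<inter> K = {}}" and ?hit = "\<lambda>U. {F. closedin Y F \<and> F \<inter> U \<noteq> {}}"
  have cK: "compactin Y (K i)" for i by (rule compact_networkD(1)[OF K])
  have sep: "\<exists>i j. K j \<subseteq> Y interior_of K i \<and>
      ((F \<inter> Y interior_of K j \<noteq> {} \<and> F' \<inter> K i = {}) \<or> (F' \<inter> Y interior_of K j \<noteq> {} \<and> F \<inter> K i = {}))"
    if F: "closedin Y F" "closedin Y F'" "F \<noteq> F'" for F F'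
  proof -
    have "(\<exists>y. y \<in> F \<and> y \<notin> F') \<or> (\<exists>y. y \<in> F' \<and> y \<notin> F)" using F(3) by blast
    then show ?thesis
      using fell_separation[OF K F(1,2)] fell_separation[OF K F(2,1)] by metis
  qed
  have int: "Y interior_of K i \<subseteq> K i" for i by (rule interior_of_subset)
  show Haus: "Hausdorff_space (fell_topology Y)"
    unfolding Hausdorff_space_def topspace_fell_topology
  proof (intro allI impI)
    fix F F' assume F: "F \<in> {F. closedin Y F} \<and> F' \<in> {F. closedin Y F} \<and> F \<noteq> F'"
    then obtain i j where ij: "K j \<subseteq> Y interior_of K i"
      "(F \<inter> Y interior_of K j \<noteq> {} \<and> F' \<inter> K i = {}) \<or> (F' \<inter> Y interior_of K j \<noteq> {} \<and> F \<inter> K i = {})"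
      using sep[of F F'] by blast
    have o: "openin (fell_topology Y) (?hit (Y interior_of K j))" "openin (fell_topology Y) (?miss (K i))"
      using openin_fell_hit openin_fell_miss cK by (metis openin_interior_of)+
    have "disjnt (?hit (Y interior_of K j)) (?miss (K i))"
      using ij(1) int[of i] int[of j] unfolding disjnt_def by blast
    then show "\<exists>U V. openin (fell_topology Y) U \<and> openin (fell_topology Y) V \<and> F \<in> U \<and> F' \<in> V \<and> disjnt U V"
      using ij(2) o F disjnt_sym by (smt (verit) mem_Collect_eq)
  qed
  define \<C> where "\<C> = range (\<lambda>i. ?hit (K i)) \<union> range (\<lambda>i. ?miss (Y interior_of K i))"
  show "metrizable_space (fell_topology Y)"
  proof (rule compact_Hausdorff_separated_imp_metrizable[OF compact_space_fell Haus, of \<C>])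
    show "countable \<C>" unfolding \<C>_def by simp
    show "closedin (fell_topology Y) C" if "C \<in> \<C>" for C
      using that closedin_fell_hit[OF cK] closedin_fell_miss[OF openin_interior_of]
      unfolding \<C>_def by blast
    fix F F' assume F: "F \<in> topspace (fell_topology Y)" "F' \<in> topspace (fell_topology Y)" "F \<noteq> F'"
    then have F': "closedin Y F" "closedin Y F'" unfolding topspace_fell_topology by simp_all
    then obtain i j where ij: "K j \<subseteq> Y interior_of K i"
      "(F \<inter> Y interior_of K j \<noteq> {} \<and> F' \<inter> K i = {}) \<or> (F' \<inter> Y interior_of K j \<noteq> {} \<and> F \<inter> K i = {})"
      using sep[OF F' F(3)] by metis
    let ?A = "?hit (K j)" and ?B = "?miss (Y interior_of K i)"
    have d: "disjnt ?A ?B" "disjnt ?B ?A"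
      using ij(1) unfolding disjnt_def by blast+
    have c: "?A \<in> \<C>" "?B \<in> \<C>" unfolding \<C>_def by blast+
    have "(F \<in> ?A \<and> F' \<in> ?B) \<or> (F' \<in> ?A \<and> F \<in> ?B)"
      using ij(2) F' int[of i] int[of j] by blast
    then show "\<exists>C\<in>\<C>. \<exists>D\<in>\<C>. F \<in> C \<and> F' \<in> D \<and> disjnt C D"
    proof (elim disjE conjE)
      assume "F \<in> ?A" "F' \<in> ?B"
      then show ?thesis using d c by (intro bexI[of _ ?A] bexI[of _ ?B] conjI)
    next
      assume "F' \<in> ?A" "F \<in> ?B"
      then show ?thesis using d c by (intro bexI[of _ ?B] bexI[of _ ?A] conjI)
    qed
  qed
qed

text \<open>The star space is of this form: removing the empty set from a closed subspace of the Fell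
  topology leaves the intersection of a closed and an open set.\<close>

lemma locally_closed_imp_standard_space:
  assumes X: "compact_space X" "metrizable_space X" and A: "closedin X A" and G: "openin X G"
  shows "standard_space (subtopology X (G \<inter> A))"
proof -
  have H: "Hausdorff_space X" using X(2) by (rule metrizable_imp_Hausdorff_space)
  have "locally_compact_space (subtopology X G)"
    using locally_compact_space_open_subset[OF disjI1[OF H] compact_imp_locally_compact_space[OF X(1)] G] .
  moreover have "closedin (subtopology X G) (G \<inter> A)"
    using A unfolding closedin_subtopology by blast
  ultimately have "locally_compact_space (subtopology (subtopology X G) (G \<inter> A))"
    by (rule locally_compact_space_closed_subset)
  then have "locally_compact_space (subtopology X (G \<inter> A))"
    by (simp add: subtopology_subtopology)
  moreover have "second_countable (subtopology X (G \<inter> A))"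
    using second_countable_subtopology compact_metrizable_imp_second_countable X by blast
  ultimately show ?thesis
    unfolding standard_space_def
    using metrizable_space_subtopology[OF X(2)] second_countable_imp_separable_space by blast
qed

section \<open>Quotients of standard spaces and limits of fibres\<close>

text \<open>A standard space is represented by a metrizable space with a compact network, so that the
  exhaustion and the countable base are available as constants.\<close>

locale standard_quotient =
  fixes X :: "'a topology" and Y :: "'b topology" and q :: "'b \<Rightarrow> 'a" and K :: "nat \<Rightarrow> 'b set"
  assumes Hausdorff: "Hausdorff_space X"
    and metrizable_Y: "metrizable_space Y"
    and network: "compact_network Y K"
    and quotient: "quotient_map Y X q"
begin

definition exh :: "nat \<Rightarrow> 'b set" where "exh n = (\<Union>i<n. K i)"

abbreviation stage :: "nat \<Rightarrow> 'a set" where "stage n \<equiv> q ` exh n"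

lemma Hausdorff_Y: "Hausdorff_space Y"
  using metrizable_Y by (rule metrizable_imp_Hausdorff_space)

lemma compact_K: "compactin Y (K i)"
  by (rule compact_networkD(1)[OF network])

lemma compact_exh: "compactin Y (exh n)"
  unfolding exh_def using compact_K by (intro compactin_Union) auto

lemma exh_subset: "exh n \<subseteq> topspace Y"
  using compact_exh compactin_subset_topspace by blast

lemma K_subset_exh: "K i \<subseteq> exh (Suc i)"
  unfolding exh_def by blast

lemma cont: "continuous_map Y X q"
  using quotient by (rule quotient_imp_continuous_map)

lemma surj: "q ` topspace Y = topspace X"
  using quotient by (rule quotient_imp_surjective_map)

lemma closed_image_compact: "compactin Y L \<Longrightarrow> closedin X (q ` L)"
  using cont image_compactin compactin_imp_closedin[OF Hausdorff] by blast

lemma closed_fibre: "x \<in> topspace X \<Longrightarrow> closedin Y (fibre Y q x)"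
  using closedin_continuous_map_preimage[OF cont closedin_Hausdorff_singleton[OF Hausdorff]]
  unfolding fibre_def by simp

lemma in_interior_K:
  assumes "y \<in> topspace Y"
  obtains i where "y \<in> Y interior_of K i"
  using compact_networkD(2)[OF network openin_topspace assms] by blast

sublocale sequential_k_omega_space X stage
proof
  fix n
  show "Hausdorff_space X" by (rule Hausdorff)
  show "compactin X (stage n)" using image_compactin[OF compact_exh cont] .
  show "stage n \<subseteq> stage (Suc n)" unfolding exh_def by (intro image_mono UN_mono) auto
  show "topspace X \<subseteq> (\<Union>n. stage n)"
  proof
    fix x assume "x \<in> topspace X"
    then obtain y where y: "y \<in> topspace Y" "x = q y" using surj by blast
    obtain i where "y \<in> Y interior_of K i" using in_interior_K[OF y(1)] by blast
    then have "y \<in> exh (Suc i)" using interior_of_subset K_subset_exh by (metis subsetD)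
    then show "x \<in> (\<Union>n. stage n)" using y(2) by blast
  qed
next
  fix A assume A: "A \<subseteq> topspace X" "\<And>n. closedin X (A \<inter> stage n)"
  have "openin Y {y \<in> topspace Y. q y \<in> topspace X - A}"
  proof (subst openin_subopen, intro ballI)
    fix y assume y: "y \<in> {y \<in> topspace Y. q y \<in> topspace X - A}"
    then obtain i where i: "y \<in> Y interior_of K i" using in_interior_K by blast
    define W where "W = Y interior_of K i \<inter> {z \<in> topspace Y. q z \<in> topspace X - (A \<inter> stage (Suc i))}"
    have "openin Y W"
      unfolding W_def
      by (intro openin_Int openin_interior_of openin_continuous_map_preimage[OF cont]
          openin_diff openin_topspace A(2))
    moreover have "y \<in> W" unfolding W_def using i y by blast
    moreover have "W \<subseteq> {y \<in> topspace Y. q y \<in> topspace X - A}"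
      unfolding W_def using interior_of_subset[of Y "K i"] K_subset_exh[of i] by blast
    ultimately show "\<exists>T. openin Y T \<and> y \<in> T \<and> T \<subseteq> {y \<in> topspace Y. q y \<in> topspace X - A}" by blast
  qed
  then have "openin X (topspace X - A)"
    using quotient unfolding quotient_map_def by (metis Diff_subset)
  then show "closedin X A" using A(1) unfolding closedin_def by simp
next
  \<comment> \<open>Lift \<open>S\<close> to the compact set \<open>exh n\<close>, where closures are sequential; the image of the closure
  of the lift is compact, hence closed, so it contains \<open>x\<close>.\<close>
  fix S n x assume S: "S \<subseteq> stage n" "x \<in> X closure_of S"
  define S' where "S' = {y \<in> exh n. q y \<in> S}"
  have qS': "q ` S' = S" unfolding S'_def using S(1) by blast
  have "Y closure_of S' \<subseteq> exh n"
    using compactin_imp_closedin[OF Hausdorff_Y compact_exh] unfolding S'_def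
    by (intro closure_of_minimal) auto
  then have "compactin Y (Y closure_of S')"
    using compact_exh closed_compactin closedin_closure_of by blast
  then have "closedin X (q ` (Y closure_of S'))" by (rule closed_image_compact)
  moreover have "S \<subseteq> q ` (Y closure_of S')"
    using closure_of_subset[of S' Y] exh_subset[of n] qS' unfolding S'_def by blast
  ultimately have "x \<in> q ` (Y closure_of S')"
    using S(2) closure_of_minimal by (metis subsetD)
  then obtain y where y: "y \<in> Y closure_of S'" "x = q y" by blast
  then obtain s where s: "range s \<subseteq> S' \<inter> topspace Y" "limitin Y s y sequentially"
    using metrizable_closure_of_sequence[OF metrizable_Y] by metis
  have "seq_in X S (q \<circ> s) x"
    unfolding seq_in_def y(2)
    using continuous_map_limit[OF cont s(2)] s(1) qS' by auto
  then show "\<exists>s. seq_in X S s x" by blast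
qed

abbreviation star :: "'b set topology" where "star \<equiv> star_space Y X q"

lemma topspace_star:
  "topspace star = fell_topology Y closure_of (fibre Y q ` topspace X) - {{}}"
  unfolding star_space_def topspace_subtopology
  using closure_of_subset_topspace[of "fell_topology Y"] by blast

lemma star_nbhd_meets_fibre:
  assumes "F \<in> topspace star" "openin (fell_topology Y) U" "F \<in> U"
  obtains x where "x \<in> topspace X" "fibre Y q x \<in> U"
proof -
  have "F \<in> fell_topology Y closure_of (fibre Y q ` topspace X)"
    using assms(1) unfolding topspace_star by simp
  then obtain S where "S \<in> fibre Y q ` topspace X" "S \<in> U"
    using assms(2,3) unfolding in_closure_of by metis
  then show ?thesis using that by blast
qed

lemma star_closed: "F \<in> topspace star \<Longrightarrow> closedin Y F"
  using closure_of_subset_topspace[of "fell_topology Y" "fibre Y q ` topspace X"]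
  unfolding topspace_star topspace_fell_topology by blast

text \<open>Disjoint neighbourhoods of \<open>q y\<close> and \<open>q y'\<close> pull back to open sets that are both hit by \<open>F\<close> but by
  no fibre.\<close>

lemma star_constant:
  assumes F: "F \<in> topspace star" and y: "y \<in> F" "y' \<in> F"
  shows "q y = q y'"
proof (rule ccontr)
  assume ne: "q y \<noteq> q y'"
  have yt: "y \<in> topspace Y" "y' \<in> topspace Y" using y star_closed[OF F] closedin_subset by blast+
  then have "q y \<in> topspace X" "q y' \<in> topspace X" using surj by blast+
  then obtain U U' where U: "openin X U" "openin X U'" "q y \<in> U" "q y' \<in> U'" "disjnt U U'"
    using Hausdorff ne unfolding Hausdorff_space_def by metis
  let ?h = "\<lambda>U. {F. closedin Y F \<and> F \<inter> {y \<in> topspace Y. q y \<in> U} \<noteq> {}}"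
  have "openin (fell_topology Y) (?h U \<inter> ?h U')"
    by (intro openin_Int openin_fell_hit openin_continuous_map_preimage[OF cont] U(1,2))
  moreover have "F \<in> ?h U \<inter> ?h U'" using y yt U star_closed[OF F] by blast
  ultimately obtain x where "fibre Y q x \<in> ?h U \<inter> ?h U'"
    by (rule star_nbhd_meets_fibre[OF F])
  then have "x \<in> U" "x \<in> U'" unfolding fibre_def by auto
  then show False using U(5) unfolding disjnt_def by blast
qed

lemma star_map_eq:
  assumes "F \<in> topspace star" "y \<in> F"
  shows "star_map q F = q y"
proof -
  have "q ` F = {q y}" using assms star_constant by blast
  then show ?thesis unfolding star_map_def by simp
qed

lemma star_nonempty: "F \<in> topspace star \<Longrightarrow> F \<noteq> {}"
  unfolding topspace_star by blast

lemma star_subset_fibre: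
  assumes "F \<in> topspace star"
  shows "F \<subseteq> fibre Y q (star_map q F)" and "star_map q F \<in> topspace X"
proof -
  have F: "F \<subseteq> topspace Y" using assms star_closed closedin_subset by blast
  then show "F \<subseteq> fibre Y q (star_map q F)"
    using star_map_eq[OF assms] unfolding fibre_def by auto
  obtain y where "y \<in> F" using star_nonempty[OF assms] by blast
  then show "star_map q F \<in> topspace X"
    using star_map_eq[OF assms] F surj by (metis image_eqI subsetD)
qed

lemma fibre_in_star:
  assumes "x \<in> topspace X"
  shows "fibre Y q x \<in> topspace star" and "star_map q (fibre Y q x) = x"
proof -
  have "x \<in> q ` topspace Y" using surj assms by simp
  then obtain y where y: "y \<in> fibre Y q x" unfolding fibre_def by blast
  have "fibre Y q ` topspace X \<subseteq> topspace (fell_topology Y)"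
    using closed_fibre unfolding topspace_fell_topology by blast
  then show *: "fibre Y q x \<in> topspace star"
    unfolding topspace_star using closure_of_subset assms y by blast
  show "star_map q (fibre Y q x) = x"
    using star_map_eq[OF * y] y unfolding fibre_def by simp
qed

lemma continuous_star_map: "continuous_map star X (star_map q)"
  unfolding continuous_map
proof (intro conjI allI impI)
  show "star_map q ` topspace star \<subseteq> topspace X" using star_subset_fibre(2) by blast
  fix U assume U: "openin X U"
  have "{F \<in> topspace star. star_map q F \<in> U} =
      topspace star \<inter> {F. closedin Y F \<and> F \<inter> {y \<in> topspace Y. q y \<in> U} \<noteq> {}}"
  proof (intro set_eqI iffI)
    fix F assume F: "F \<in> {F \<in> topspace star. star_map q F \<in> U}"
    then obtain y where y: "y \<in> F" using star_nonempty by blast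
    have "closedin Y F" "star_map q F = q y" using F y star_closed star_map_eq by blast+
    moreover have "y \<in> topspace Y" using y closedin_subset calculation(1) by blast
    ultimately show "F \<in> topspace star \<inter> {F. closedin Y F \<and> F \<inter> {y \<in> topspace Y. q y \<in> U} \<noteq> {}}"
      using F y by auto
  qed (use star_map_eq in auto)
  moreover have "openin (fell_topology Y) {F. closedin Y F \<and> F \<inter> {y \<in> topspace Y. q y \<in> U} \<noteq> {}}"
    by (intro openin_fell_hit openin_continuous_map_preimage[OF cont U])
  ultimately show "openin star {F \<in> topspace star. star_map q F \<in> U}"
    using topspace_star unfolding star_space_def openin_subtopology
    by (metis (no_types, lifting) inf_commute)
qed

lemma standard_star_closed:
  assumes "closedin star V"
  shows "standard_space (subtopology star V)"
proof -
  let ?F = "fell_topology Y" and ?S = "fell_topology Y closure_of (fibre Y q ` topspace X)"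
  note m = compact_network_fell_metrizable[OF network]
  obtain T where T: "closedin ?F T" "V = T \<inter> (?S - {{}})"
    using assms unfolding star_space_def closedin_subtopology by blast
  have "?S \<subseteq> topspace ?F" by (rule closure_of_subset_topspace)
  then have V: "V = (topspace ?F - {{}}) \<inter> (T \<inter> ?S)" unfolding T(2) by blast
  have "openin ?F (topspace ?F - {{}})"
    by (intro openin_diff openin_topspace closedin_Hausdorff_singleton[OF m(1)])
      (simp add: topspace_fell_topology)
  then have "standard_space (subtopology ?F V)"
    unfolding V using T(1) by (intro locally_closed_imp_standard_space compact_space_fell m(2)) auto
  moreover have "subtopology star V = subtopology ?F V"
    unfolding star_space_def subtopology_subtopology using T(2) by (simp add: Int_absorb1 Int_commute)
  ultimately show ?thesis by simp
qed

text \<open>Each open set that meets the fibre of \<open>x\<close> has an image that eventually contains every sequence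
  converging to \<open>x\<close>. Equivalently, the fibres of the members of such a sequence converge to the
  whole fibre of \<open>x\<close>.\<close>

definition regular_value :: "'a \<Rightarrow> bool" where
  "regular_value x \<longleftrightarrow> x \<in> topspace X \<and>
     (\<forall>U k. openin Y U \<and> U \<inter> fibre Y q x \<noteq> {} \<longrightarrow> x \<notin> X closure_of (stage k - q ` U))"

text \<open>A member \<open>F\<close> of the star space over \<open>x\<close> is contained in the fibre of \<open>x\<close>. If it omitted a
  point \<open>y\<close> of that fibre, then fibres over points near \<open>x\<close> and inside one stage would approximate \<open>F\<close>
  while missing a neighbourhood of \<open>y\<close>, against regularity.\<close>

lemma regular_value_singleton_fibre:
  assumes x: "regular_value x"
  shows "fibre Y q x \<in> singleton_fibres Y X q"
proof -
  have xt: "x \<in> topspace X" using x unfolding regular_value_def by blast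
  have "F = fibre Y q x" if F: "F \<in> topspace star" "star_map q F = x" for F
  proof
    show sub: "F \<subseteq> fibre Y q x" using star_subset_fibre(1)[OF F(1)] F(2) by simp
    show "fibre Y q x \<subseteq> F"
    proof (rule subsetI, rule ccontr)
      fix y assume y: "y \<in> fibre Y q x" "y \<notin> F"
      have cF: "closedin Y F" using star_closed F(1) .
      have "y \<in> topspace Y - F" using y unfolding fibre_def by blast
      then obtain i where i: "y \<in> Y interior_of K i" "K i \<subseteq> topspace Y - F"
        using compact_networkD(2)[OF network] cF by (metis openin_diff openin_topspace)
      obtain p where p: "p \<in> F" using star_nonempty[OF F(1)] by blast
      have pt: "p \<in> topspace Y" "q p = x" using p sub unfolding fibre_def by auto
      obtain j where j: "p \<in> Y interior_of K j" using in_interior_K pt(1) by blast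
      let ?U = "Y interior_of K i"
      \<comment> \<open>Inside the stage that contains \<open>q ` K j\<close>, all points of \<open>W\<close> have fibres that meet \<open>?U\<close>.\<close>
      define W where "W = topspace X - X closure_of (stage (Suc j) - q ` ?U)"
      have "openin X W" unfolding W_def by (intro openin_diff openin_topspace closedin_closure_of)
      have "?U \<inter> fibre Y q x \<noteq> {}" using i(1) y(1) by blast
      then have "x \<in> W"
        using x xt openin_interior_of unfolding W_def regular_value_def by (metis DiffI)
      define P where "P = Y interior_of K j \<inter> {z \<in> topspace Y. q z \<in> W}"
      have oP: "openin Y P"
        unfolding P_def
        by (intro openin_Int openin_interior_of openin_continuous_map_preimage[OF cont \<open>openin X W\<close>])
      let ?N = "{F. closedin Y F \<and> F \<inter> K i = {}} \<inter> {F. closedin Y F \<and> F \<inter> P \<noteq> {}}"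
      have "openin (fell_topology Y) ?N"
        by (intro openin_Int openin_fell_miss compact_K openin_fell_hit oP)
      moreover have "F \<in> ?N"
        using cF i(2) p j pt \<open>x \<in> W\<close> unfolding P_def by auto
      ultimately obtain x' where x': "x' \<in> topspace X" "fibre Y q x' \<in> ?N"
        using star_nbhd_meets_fibre[OF F(1)] by blast
      then obtain z where z: "z \<in> P" "q z = x'" unfolding fibre_def by blast
      have "x' \<in> stage (Suc j)"
        using z interior_of_subset[of Y "K j"] K_subset_exh[of j] unfolding P_def by blast
      moreover have "x' \<in> W" using z unfolding P_def by blast
      ultimately have "x' \<in> q ` ?U"
        using closure_of_subset_Int[of X "stage (Suc j) - q ` ?U"] x'(1) unfolding W_def by blast
      then obtain u where u: "u \<in> ?U" "x' = q u" by blast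
      then have "u \<in> K i" "u \<in> topspace Y"
        using interior_of_subset[of Y "K i"] interior_of_subset_topspace[of Y "K i"] by blast+
      then have "u \<in> fibre Y q x' \<inter> K i" using u unfolding fibre_def by simp
      then show False using x'(2) by blast
    qed
  qed
  then have "fibre star (star_map q) x = {fibre Y q x}"
    unfolding fibre_def[of star] using fibre_in_star[OF xt] by blast
  then show ?thesis
    unfolding singleton_fibres_def using fibre_in_star[OF xt] by simp
qed

text \<open>Baire category in the compact space \<open>core_stage n\<close>. The sets \<open>bad1 k\<close> make up the complement of
  \<open>inner_stage n\<close>, which is dense. The set \<open>bad2 i\<close> is the relative boundary of the closed set
  \<open>q ` K i\<close>, so off these sets \<open>x \<in> q ` K i\<close> only if \<open>q ` K i\<close> is a neighbourhood of \<open>x\<close> in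
  \<open>core_stage n\<close>. For points of \<open>inner_stage n\<close> this relative statement suffices, because
  \<open>core_stage n\<close> is a sequential neighbourhood of them.\<close>

lemma regular_values_dense:
  assumes "core_determined"
  shows "core_stage n \<subseteq> X closure_of {x \<in> core_stage n. regular_value x}"
proof -
  let ?D = "subtopology X (core_stage n)"
  have cD: "closedin X (core_stage n)" unfolding core_stage_def by simp
  have tD: "topspace ?D = core_stage n"
    using closedin_subset[OF cD] by (simp add: Int_absorb1)
  define bad1 where "bad1 k = X closure_of (stage k - stage n) \<inter> core_stage n" for k
  define bad2 where "bad2 i = X closure_of (core_stage n - q ` K i) \<inter> q ` K i \<inter> core_stage n" for i
  let ?G = "range bad1 \<union> range bad2"
  have "?D interior_of \<Union>?G = {}"
  proof (rule Baire_category_alt)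
    have "compact_space ?D" using compact_core_stage by (simp add: compactin_subspace)
    moreover have "Hausdorff_space ?D" using Hausdorff by (rule Hausdorff_space_subtopology)
    ultimately show "completely_metrizable_space ?D \<or> locally_compact_space ?D \<and> regular_space ?D"
      using compact_imp_locally_compact_space compact_Hausdorff_imp_regular_space by blast
    show "countable ?G" by simp
    fix T assume T: "T \<in> ?G"
    have emptyI: "?D interior_of T = {}" if "\<And>W. \<lbrakk>openin X W; W \<inter> core_stage n \<subseteq> T\<rbrakk> \<Longrightarrow> W \<inter> core_stage n = {}"
      using that unfolding interior_of_def openin_subtopology by blast
    from T consider k where "T = bad1 k" | i where "T = bad2 i" by blast
    then show "closedin ?D T \<and> ?D interior_of T = {}"
    proof cases
      case (1 k)
      have "W \<inter> core_stage n = {}" if W: "openin X W" "W \<inter> core_stage n \<subseteq> bad1 k" for W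
      proof -
        have "W \<inter> inner_stage n = {}"
          using W(2) inner_stage_subset_core[of n] unfolding bad1_def inner_stage_def by blast
        then show ?thesis
          using openin_Int_closure_of_eq_empty[OF W(1)] unfolding core_stage_def by blast
      qed
      moreover have "closedin ?D T"
        unfolding 1 bad1_def closedin_subtopology
        by (intro exI[of _ "X closure_of (stage k - stage n)"]) simp
      ultimately show ?thesis using emptyI 1 by blast
    next
      case (2 i)
      have "W \<inter> core_stage n = {}" if W: "openin X W" "W \<inter> core_stage n \<subseteq> bad2 i" for W
      proof -
        have "W \<inter> (core_stage n - q ` K i) = {}"
          using W(2) unfolding bad2_def by blast
        then have "W \<inter> X closure_of (core_stage n - q ` K i) = {}"
          using openin_Int_closure_of_eq_empty[OF W(1)] by blast
        then show ?thesis using W(2) unfolding bad2_def by blast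
      qed
      moreover have "closedin ?D T"
        unfolding 2 bad2_def closedin_subtopology
        by (intro exI[of _ "X closure_of (core_stage n - q ` K i) \<inter> q ` K i"] conjI closedin_Int
            closedin_closure_of closed_image_compact compact_K refl)
      ultimately show ?thesis using emptyI 2 by blast
    qed
  qed
  then have dense: "?D closure_of (core_stage n - \<Union>?G) = core_stage n"
    using closure_of_complement[of ?D "\<Union>?G"] tD by simp
  have reg: "regular_value x" if x: "x \<in> core_stage n - \<Union>?G" for x
    unfolding regular_value_def
  proof (intro conjI allI impI)
    have xt: "x \<in> topspace X" using x cD closedin_subset by blast
    then show "x \<in> topspace X" .
    fix U k assume U: "openin Y U \<and> U \<inter> fibre Y q x \<noteq> {}"
    then obtain y where y: "y \<in> U" "y \<in> topspace Y" "q y = x" unfolding fibre_def by blast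
    then obtain i where i: "y \<in> Y interior_of K i" "K i \<subseteq> U"
      using compact_networkD(2)[OF network] U by blast
    have "x \<in> q ` K i" using i(1) interior_of_subset[of Y "K i"] y(3) by blast
    moreover have "x \<notin> bad2 i" using x by blast
    ultimately have 1: "x \<notin> X closure_of (core_stage n - q ` K i)" using x unfolding bad2_def by blast
    have "x \<in> inner_stage n" using x xt unfolding inner_stage_def bad1_def by blast
    then have 2: "x \<notin> X closure_of (stage k - core_stage n)"
      using inner_stage_nbhd_core[OF assms] by blast
    have "stage k - q ` U \<subseteq> (stage k - core_stage n) \<union> (core_stage n - q ` K i)"
      using i(2) by blast
    then have "X closure_of (stage k - q ` U) \<subseteq>
        X closure_of (stage k - core_stage n) \<union> X closure_of (core_stage n - q ` K i)"
      using closure_of_mono closure_of_Un by metis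
    then show "x \<notin> X closure_of (stage k - q ` U)" using 1 2 by blast
  qed
  have "core_stage n \<subseteq> X closure_of (core_stage n - \<Union>?G)"
    using dense closure_of_subtopology_subset by metis
  also have "\<dots> \<subseteq> X closure_of {x \<in> core_stage n. regular_value x}"
    using reg by (intro closure_of_mono) blast
  finally show ?thesis .
qed

lemma closed_core_set: "closedin star (core_set Y X q)"
  unfolding core_set_def by simp

lemma singleton_subset_core_set: "singleton_fibres Y X q \<subseteq> core_set Y X q"
  unfolding core_set_def by (rule closure_of_subset) (auto simp: singleton_fibres_def)

text \<open>Only the empty set is missing from the star space, and sets that meet the compact set \<open>L\<close> do
  not accumulate at it.\<close>

lemma compact_star_hit:
  assumes "closedin star V" "compactin Y L"
  shows "compactin star (V \<inter> {F. F \<inter> L \<noteq> {}})"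
proof -
  let ?F = "fell_topology Y" and ?S = "fell_topology Y closure_of (fibre Y q ` topspace X)"
  let ?H = "{F. closedin Y F \<and> F \<inter> L \<noteq> {}}"
  obtain T where T: "closedin ?F T" "V = T \<inter> (?S - {{}})"
    using assms(1) unfolding star_space_def closedin_subtopology by blast
  have "closedin ?F (T \<inter> ?S \<inter> ?H)" 
    by (intro closedin_Int T(1) closedin_closure_of closedin_fell_hit assms(2))
  then have "compactin ?F (T \<inter> ?S \<inter> ?H)" by (rule closedin_compact_space[OF compact_space_fell])
  moreover have "T \<inter> ?S \<inter> ?H = V \<inter> {F. F \<inter> L \<noteq> {}}"
    using T closedin_subset[OF T(1)] unfolding topspace_fell_topology by auto
  ultimately show ?thesis
    unfolding star_space_def compactin_subtopology using T(2) by auto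
qed

text \<open>The members of \<open>core_set Y X q\<close> that meet \<open>exh m\<close> form a compact set, whose image is closed and, for
  large \<open>m\<close>, contains the regular values in \<open>core_stage n\<close> and therefore \<open>core_stage n\<close> itself.
  Applied to a saturated closed set, the same compactness shows that its image has closed traces on
  the core stages.\<close>

theorem core_determined_imp_irreducible:
  assumes "core_determined"
  shows "quotient_map (subtopology star (core_set Y X q)) X (star_map q)"
    and "irreducible_map (subtopology star (core_set Y X q)) X (star_map q)"
proof -
  let ?V = "core_set Y X q"
  have Vsub: "?V \<subseteq> topspace star" using closed_core_set closedin_subset by blast
  then have tV: "topspace (subtopology star ?V) = ?V" by (simp add: Int_absorb1)
  interpret core: k_omega_space X core_stage
    using assms by (rule core_determined_k_omega)
  have contV: "continuous_map (subtopology star ?V) X (star_map q)"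
    using continuous_star_map by (rule continuous_map_from_subtopology)
  have lift: "\<exists>m. core_stage n \<subseteq> star_map q ` (?V \<inter> {F. F \<inter> exh m \<noteq> {}})" for n
  proof -
    obtain m where m: "core_stage n \<subseteq> stage m"
      using compact_subset_stage[OF compact_core_stage] by blast
    let ?P = "?V \<inter> {F. F \<inter> exh m \<noteq> {}}"
    have "closedin X (star_map q ` ?P)"
      using image_compactin[OF compact_star_hit[OF closed_core_set compact_exh] continuous_star_map]
        compactin_imp_closedin[OF Hausdorff] by blast
    moreover have "{x \<in> core_stage n. regular_value x} \<subseteq> star_map q ` ?P"
    proof
      fix x assume x: "x \<in> {x \<in> core_stage n. regular_value x}"
      then have xt: "x \<in> topspace X" unfolding regular_value_def by blast
      obtain y where "y \<in> exh m" "q y = x" using x m by blast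
      then have "fibre Y q x \<inter> exh m \<noteq> {}" using exh_subset[of m] unfolding fibre_def by blast
      then have "fibre Y q x \<in> ?P"
        using x regular_value_singleton_fibre singleton_subset_core_set by blast
      then show "x \<in> star_map q ` ?P" using fibre_in_star(2)[OF xt] by (metis image_eqI)
    qed
    ultimately have "X closure_of {x \<in> core_stage n. regular_value x} \<subseteq> star_map q ` ?P"
      by (simp add: closure_of_minimal)
    then show ?thesis using regular_values_dense[OF assms, of n] by blast
  qed
  have onto: "star_map q ` ?V = topspace X"
  proof
    show "star_map q ` ?V \<subseteq> topspace X" using Vsub star_subset_fibre(2) by blast
    show "topspace X \<subseteq> star_map q ` ?V"
    proof
      fix x assume "x \<in> topspace X"
      then obtain n where "x \<in> core_stage n" using core.cover by blast
      then show "x \<in> star_map q ` ?V" using lift[of n] by blast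
    qed
  qed
  show "quotient_map (subtopology star ?V) X (star_map q)"
    unfolding quotient_map_closedin tV
  proof (intro conjI allI impI iffI)
    show "star_map q ` ?V = topspace X" by (rule onto)
    fix A assume A: "A \<subseteq> topspace X"
    show "closedin (subtopology star ?V) {F \<in> ?V. star_map q F \<in> A}" if "closedin X A"
      using closedin_continuous_map_preimage[OF contV that] unfolding tV .
    assume cl: "closedin (subtopology star ?V) {F \<in> ?V. star_map q F \<in> A}"
    then have cl': "closedin star {F \<in> ?V. star_map q F \<in> A}"
      using closed_core_set closedin_trans_full by blast
    show "closedin X A"
    proof (rule core.closed_if_closed_in_stages[OF A])
      fix n
      obtain m where m: "core_stage n \<subseteq> star_map q ` (?V \<inter> {F. F \<inter> exh m \<noteq> {}})" using lift by blast
      let ?Q = "{F \<in> ?V. star_map q F \<in> A} \<inter> {F. F \<inter> exh m \<noteq> {}}"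
      have "closedin X (star_map q ` ?Q)"
        using image_compactin[OF compact_star_hit[OF cl' compact_exh] continuous_star_map]
          compactin_imp_closedin[OF Hausdorff] by blast
      then have "closedin X (star_map q ` ?Q \<inter> core_stage n)" using core.closed_stage by blast
      moreover have "star_map q ` ?Q \<inter> core_stage n = A \<inter> core_stage n" using m by blast
      ultimately show "closedin X (A \<inter> core_stage n)" by simp
    qed
  qed
  show "irreducible_map (subtopology star ?V) X (star_map q)"
    unfolding irreducible_map_def tV
  proof (intro conjI notI)
    show "star_map q ` ?V = topspace X" by (rule onto)
    assume "\<exists>W. closedin (subtopology star ?V) W \<and> W \<subset> ?V \<and> star_map q ` W = topspace X"
    then obtain W where W: "closedin (subtopology star ?V) W" "W \<subset> ?V" "star_map q ` W = topspace X"
      by blast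
    have "closedin star W" using W(1) closed_core_set closedin_trans_full by blast
    moreover have "singleton_fibres Y X q \<subseteq> W"
    proof
      fix z assume z: "z \<in> singleton_fibres Y X q"
      then have zt: "z \<in> topspace star" "fibre star (star_map q) (star_map q z) = {z}"
        unfolding singleton_fibres_def by auto
      have "star_map q z \<in> star_map q ` W" using W(3) star_subset_fibre(2)[OF zt(1)] by simp
      then obtain w where w: "w \<in> W" "star_map q w = star_map q z" by auto
      then have "w \<in> fibre star (star_map q) (star_map q z)"
        using W(2) Vsub unfolding fibre_def by blast
      then show "z \<in> W" using zt(2) w(1) by simp
    qed
    ultimately have "?V \<subseteq> W" unfolding core_set_def by (simp add: closure_of_minimal)
    then show False using W(2) by blast
  qed
qed

end

section \<open>Irreducible quotients of standard spaces\<close>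

locale irreducible_quotient = standard_quotient +
  assumes irreducible: "irreducible_map Y X q"
begin

definition unique_points :: "'b set" where
  "unique_points = {y \<in> topspace Y. \<forall>y'\<in>topspace Y. q y' = q y \<longrightarrow> y' = y}"

text \<open>Otherwise the complement of \<open>W\<close> would be a proper closed set that still maps onto \<open>X\<close>.\<close>

lemma open_not_covered_by_disjoint:
  assumes W: "openin Y W" "W \<subseteq> {y \<in> topspace Y. q y \<in> q ` A}" and A: "A \<subseteq> topspace Y" "disjnt W A"
  shows "W = {}"
proof (rule ccontr)
  assume ne: "W \<noteq> {}"
  have "q ` (topspace Y - W) = topspace X"
  proof
    show "topspace X \<subseteq> q ` (topspace Y - W)"
    proof
      fix x assume "x \<in> topspace X"
      then obtain y where y: "y \<in> topspace Y" "x = q y" using surj by blast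
      show "x \<in> q ` (topspace Y - W)"
      proof (cases "y \<in> W")
        case True
        then obtain a where "a \<in> A" "q y = q a" using W(2) by blast
        moreover have "a \<in> topspace Y - W" using \<open>a \<in> A\<close> A unfolding disjnt_def by blast
        ultimately show ?thesis using y(2) by simp
      qed (use y in simp)
    qed
  qed (use surj in blast)
  moreover have "closedin Y (topspace Y - W)" using W(1) by blast
  moreover have "topspace Y - W \<subset> topspace Y" using ne openin_subset[OF W(1)] by blast
  ultimately show False using irreducible unfolding irreducible_map_def by blast
qed

text \<open>If \<open>y\<close> shares its fibre with another point, disjoint network sets \<open>K i\<close> and \<open>K j\<close> around that
  point and \<open>y\<close> put \<open>y\<close> into the closed set of those points of \<open>K j\<close> whose fibre meets \<open>K i\<close>. By
  irreducibility these countably many closed sets have empty interior.\<close>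

lemma unique_points_dense: "Y closure_of unique_points = topspace Y"
proof -
  define B where "B = (\<lambda>(i, j). {y \<in> topspace Y. q y \<in> q ` K i} \<inter> K j)"
  define I where "I = {(i, j). disjnt (K i) (K j)}"
  have B: "topspace Y - \<Union>(B ` I) \<subseteq> unique_points"
  proof
    fix y assume y: "y \<in> topspace Y - \<Union>(B ` I)"
    have "y' = y" if y': "y' \<in> topspace Y" "q y' = q y" for y'
    proof (rule ccontr)
      assume "y' \<noteq> y"
      then obtain U V where U: "openin Y U" "openin Y V" "y' \<in> U" "y \<in> V" "disjnt U V"
        using Hausdorff_Y y y'(1) unfolding Hausdorff_space_def by (metis DiffD1)
      obtain i where i: "y' \<in> Y interior_of K i" "K i \<subseteq> U"
        using compact_networkD(2)[OF network U(1,3)] by blast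
      obtain j where j: "y \<in> Y interior_of K j" "K j \<subseteq> V"
        using compact_networkD(2)[OF network U(2,4)] by blast
      have "disjnt (K i) (K j)" using i(2) j(2) U(5) unfolding disjnt_def by blast
      then have "(i, j) \<in> I" unfolding I_def by simp
      moreover have "y' \<in> K i" "y \<in> K j"
        using i(1) j(1) interior_of_subset[of Y "K i"] interior_of_subset[of Y "K j"] by blast+
      then have "y \<in> B (i, j)" unfolding B_def using y y'(2) by (simp add: image_eqI[of "q y" q y'])
      ultimately show False using y by blast
    qed
    then show "y \<in> unique_points" using y unfolding unique_points_def by blast
  qed
  have "Y interior_of \<Union>(B ` I) = {}"
  proof (rule Baire_category_alt)
    show "completely_metrizable_space Y \<or> locally_compact_space Y \<and> regular_space Y"
    proof (rule disjI2)
      have "\<exists>U C. openin Y U \<and> compactin Y C \<and> y \<in> U \<and> U \<subseteq> C" if y: "y \<in> topspace Y" for y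
      proof -
        obtain i where "y \<in> Y interior_of K i" using in_interior_K[OF y] by blast
        then show ?thesis
          by (intro exI[of _ "Y interior_of K i"] exI[of _ "K i"])
            (simp add: compact_K interior_of_subset)
      qed
      then have "locally_compact_space Y" unfolding locally_compact_space_def by blast
      then show "locally_compact_space Y \<and> regular_space Y"
        using metrizable_imp_regular_space[OF metrizable_Y] by simp
    qed
    show "countable (B ` I)" by simp
    fix T assume "T \<in> B ` I"
    then obtain i j where ij: "disjnt (K i) (K j)" "T = {y \<in> topspace Y. q y \<in> q ` K i} \<inter> K j"
      unfolding B_def I_def by auto
    have "closedin Y T"
      unfolding ij(2)
      by (intro closedin_Int closedin_continuous_map_preimage[OF cont] closed_image_compact compact_K
          compactin_imp_closedin[OF Hausdorff_Y])
    moreover have "Y interior_of T = {}"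
    proof (rule open_not_covered_by_disjoint[of _ "K i"])
      show "Y interior_of T \<subseteq> {y \<in> topspace Y. q y \<in> q ` K i}"
        using interior_of_subset[of Y T] ij(2) by blast
      show "K i \<subseteq> topspace Y" by (rule compactin_subset_topspace[OF compact_K])
      show "disjnt (Y interior_of T) (K i)"
        using interior_of_subset[of Y T] ij unfolding disjnt_def by blast
    qed simp
    ultimately show "closedin Y T \<and> Y interior_of T = {}" by simp
  qed
  then have "Y closure_of (topspace Y - \<Union>(B ` I)) = topspace Y"
    by (simp add: closure_of_complement)
  then show ?thesis
    using closure_of_mono[OF B, of Y] closure_of_subset_topspace[of Y] by blast
qed

text \<open>A sequence of values outside \<open>q ` W\<close> would lift into the compact set \<open>exh k - W\<close> for some
  \<open>k\<close>, so its limit \<open>q z\<close> would have a preimage outside \<open>W\<close>, although \<open>z\<close> is its only preimage.\<close>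

lemma unique_point_image_nbhd:
  assumes z: "z \<in> unique_points" "z \<in> W" and W: "openin Y W" and s: "seq_in X (topspace X) s (q z)"
  shows "eventually (\<lambda>n. s n \<in> q ` W) sequentially"
proof (rule ccontr)
  assume "\<not> ?thesis"
  then obtain r where r: "strict_mono r" "seq_in X (topspace X - q ` W) (s \<circ> r) (q z)"
    using seq_in_frequently_subseq[OF s] by blast
  then obtain k where "range (s \<circ> r) \<subseteq> stage k"
    using convergent_sequence_in_stage[OF seq_in_mono[OF r(2) Diff_subset]] by metis
  then have "seq_in X (q ` (exh k - W)) (s \<circ> r) (q z)"
    using r(2) unfolding seq_in_def by blast
  then have "q z \<in> X closure_of (q ` (exh k - W))" by (rule seq_in_closure_of)
  moreover have "compactin Y (exh k \<inter> (topspace Y - W))"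
    by (intro compact_Int_closedin compact_exh closedin_diff closedin_topspace W)
  then have "closedin X (q ` (exh k \<inter> (topspace Y - W)))" by (rule closed_image_compact)
  moreover have "exh k \<inter> (topspace Y - W) = exh k - W" using exh_subset[of k] by blast
  ultimately have "q z \<in> q ` (exh k - W)" by (simp add: closure_of_closedin)
  then obtain z' where "z' \<in> exh k" "z' \<notin> W" "q z' = q z" by auto
  then show False using z exh_subset[of k] unfolding unique_points_def by blast
qed

lemma lift_in_unique:
  assumes "z \<in> unique_points" "q z \<in> stage k"
  shows "z \<in> exh k"
proof -
  obtain y where y: "y \<in> exh k" "q z = q y" using assms(2) by (elim imageE)
  then have "y \<in> topspace Y" using exh_subset by blast
  then have "y = z" using assms(1) y(2) unfolding unique_points_def by simp
  then show ?thesis using y(1) by simp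
qed

lemma unique_values_sequentially_dense: "sequentially_dense X (q ` unique_points)"
  unfolding sequentially_dense_def
proof (intro conjI ballI)
  show "q ` unique_points \<subseteq> topspace X" using surj unfolding unique_points_def by blast
  fix x assume "x \<in> topspace X"
  then obtain y where y: "y \<in> topspace Y" "x = q y" using surj by blast
  then obtain s where s: "range s \<subseteq> unique_points \<inter> topspace Y" "limitin Y s y sequentially"
    using metrizable_closure_of_sequence[OF metrizable_Y] unique_points_dense by metis
  have "seq_in X (q ` unique_points) (q \<circ> s) x"
    unfolding seq_in_def y(2) using continuous_map_limit[OF cont s(2)] s(1) by auto
  then show "\<exists>s. seq_in X (q ` unique_points) s x" by blast
qed

lemma unique_values_compact_type:
  assumes "x \<in> q ` unique_points"
  shows "compact_type_point X x"
proof -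
  obtain z where z: "z \<in> unique_points" "x = q z" using assms by blast
  then have zt: "z \<in> topspace Y" unfolding unique_points_def by blast
  then obtain i where i: "z \<in> Y interior_of K i" using in_interior_K by blast
  have "eventually (\<lambda>n. s n \<in> q ` K i) sequentially" if "seq_in X (topspace X) s x" for s
    using unique_point_image_nbhd[OF z(1) i openin_interior_of that[unfolded z(2)]]
    by (rule eventually_mono) (use interior_of_subset[of Y "K i"] in blast)
  moreover have "compactin X (q ` K i)" by (rule image_compactin[OF compact_K cont])
  ultimately show ?thesis
    using zt z(2) surj unfolding compact_type_point_def by blast
qed

text \<open>The lifts of the given sequence have a convergent subsequence, and all but finitely many of its
  terms lie in the interior of one compact neighbourhood \<open>K i\<close> of the limit. Then
  \<open>q ` K i\<close> is the required compact set.\<close>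

lemma unique_values_property_a: "property_a X (q ` unique_points)"
  unfolding property_a_def
proof (intro allI impI)
  fix x x0 assume "inj x \<and> seq_in X (q ` unique_points) x x0"
  then have x: "seq_in X (q ` unique_points) x x0" by simp
  have "q ` unique_points \<subseteq> topspace X"
    using unique_values_sequentially_dense unfolding sequentially_dense_def by simp
  then obtain k where k: "range x \<subseteq> stage k"
    using convergent_sequence_in_stage[OF seq_in_mono[OF x]] by metis
  have "\<forall>n. \<exists>z. z \<in> unique_points \<and> q z = x n" using seq_inD(1)[OF x] by (metis imageE)
  then obtain z where z: "\<And>n. z n \<in> unique_points" "\<And>n. q (z n) = x n" by metis
  have "range z \<subseteq> exh k"
    using lift_in_unique[OF z(1)] z(2) k by (metis image_subset_iff rangeI)
  then obtain l r where r: "strict_mono (r :: nat \<Rightarrow> nat)" "l \<in> exh k" "limitin Y (z \<circ> r) l sequentially"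
    using metrizable_compactin_subsequence[OF metrizable_Y compact_exh] by metis
  then obtain i where i: "l \<in> Y interior_of K i" using in_interior_K exh_subset[of k] by blast
  let ?W = "Y interior_of K i"
  have "eventually (\<lambda>n. (z \<circ> r) n \<in> ?W) sequentially"
    using limitinD[OF r(3) openin_interior_of i] .
  then obtain N where N: "\<And>n. n \<ge> N \<Longrightarrow> z (r n) \<in> ?W"
    unfolding eventually_sequentially by auto
  define r' where "r' n = r (n + N)" for n
  show "\<exists>r. strict_mono (r :: nat \<Rightarrow> nat) \<and>
      (\<forall>s :: nat \<Rightarrow> nat \<Rightarrow> 'a. (\<forall>n. seq_in X (topspace X) (s n) (x (r n))) \<longrightarrow>
         (\<exists>k :: nat \<Rightarrow> nat. compactin X (X closure_of {s n j | n j. k n \<le> j})))"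
  proof (rule exI[of _ r'], intro conjI allI impI)
    show "strict_mono r'" using r(1) unfolding r'_def strict_mono_def by simp
    fix s :: "nat \<Rightarrow> nat \<Rightarrow> 'a"
    assume s: "\<forall>n. seq_in X (topspace X) (s n) (x (r' n))"
    have "\<exists>k. \<forall>j\<ge>k. s n j \<in> q ` ?W" for n
      using unique_point_image_nbhd[OF z(1) N openin_interior_of, of "n + N" "s n"] s z(2)
      unfolding eventually_sequentially r'_def by simp
    then obtain k where k: "\<And>n j. k n \<le> j \<Longrightarrow> s n j \<in> q ` ?W" by metis
    have "{s n j | n j. k n \<le> j} \<subseteq> q ` K i"
      using k interior_of_subset[of Y "K i"] by blast
    then have "X closure_of {s n j | n j. k n \<le> j} \<subseteq> q ` K i"
      using closed_image_compact[OF compact_K] by (rule closure_of_minimal)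
    then have "compactin X (X closure_of {s n j | n j. k n \<le> j})"
      by (rule closed_compactin[OF image_compactin[OF compact_K cont]]) simp
    then show "\<exists>k :: nat \<Rightarrow> nat. compactin X (X closure_of {s n j | n j. k n \<le> j})"
      by (rule exI[of _ k])
  qed
qed

text \<open>Choose unique points within distance \<open>1 / Suc n\<close> of the \<open>n\<close>-th term of a convergent sequence of
  lifts: the uniform bound on each row makes all diagonals converge to the same limit.\<close>

lemma unique_values_property_b: "property_b X (q ` unique_points)"
  unfolding property_b_def
proof (intro allI impI)
  fix x x0 assume "inj x \<and> seq_in X (topspace X) x x0"
  then have x: "seq_in X (topspace X) x x0" by simp
  obtain k where k: "range x \<subseteq> stage k" using convergent_sequence_in_stage[OF x] by metis
  then have "\<forall>n. \<exists>z. z \<in> exh k \<and> q z = x n" by (metis imageE rangeI subsetD)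
  then obtain z where z: "\<And>n. z n \<in> exh k" "\<And>n. q (z n) = x n" by metis
  have "range z \<subseteq> exh k" using z(1) by blast
  then obtain l r where r: "strict_mono (r :: nat \<Rightarrow> nat)" "l \<in> exh k" "limitin Y (z \<circ> r) l sequentially"
    using metrizable_compactin_subsequence[OF metrizable_Y compact_exh] by metis
  have "x0 = q l"
  proof (rule limitin_Hausdorff_unique)
    show "limitin X (x \<circ> r) x0 sequentially"
      using limitin_subsequence[OF r(1) seq_inD(2)[OF x]] .
    have "q \<circ> (z \<circ> r) = x \<circ> r" using z(2) by auto
    then show "limitin X (x \<circ> r) (q l) sequentially"
      using continuous_map_limit[OF cont r(3)] by simp
  qed (simp_all add: Hausdorff)
  obtain M d where M: "Metric_space M d" and Y: "Y = Metric_space.mtopology M d"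
    using metrizable_Y unfolding metrizable_space_def by blast
  interpret d: Metric_space M d by (fact M)
  have "\<exists>t. range t \<subseteq> unique_points \<inter> M \<and> limitin Y t (z (r n)) sequentially \<and>
      (\<forall>j. d (t j) (z (r n)) < 1 / Suc n)" for n
  proof -
    have "z (r n) \<in> Y closure_of unique_points"
      using z(1) exh_subset[of k] unique_points_dense by blast
    then obtain t where t: "range t \<subseteq> unique_points \<inter> topspace Y" "limitin Y t (z (r n)) sequentially"
      using metrizable_closure_of_sequence[OF metrizable_Y] by metis
    have "eventually (\<lambda>j. t j \<in> M \<and> d (t j) (z (r n)) < 1 / Suc n) sequentially"
      using t(2) unfolding Y d.limitin_metric by (simp del: of_nat_Suc)
    then obtain J where J: "\<And>j. j \<ge> J \<Longrightarrow> d (t j) (z (r n)) < 1 / Suc n"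
      unfolding eventually_sequentially by blast
    have "limitin Y (\<lambda>j. t (j + J)) (z (r n)) sequentially"
      using t(2) by (rule limitin_sequentially_offset)
    then show ?thesis
      using t(1) J Y by (intro exI[of _ "\<lambda>j. t (j + J)"]) (auto simp: image_subset_iff)
  qed
  then obtain t where t: "\<And>n. range (t n) \<subseteq> unique_points \<inter> M"
    "\<And>n. limitin Y (t n) (z (r n)) sequentially" "\<And>n j. d (t n j) (z (r n)) < 1 / Suc n"
    by metis
  have tM: "t n j \<in> M" for n j using t(1)[of n] by blast
  have diag: "limitin Y (\<lambda>n. t n (j n)) l sequentially" for j :: "nat \<Rightarrow> nat"
    unfolding Y d.limitin_metric
  proof (intro conjI allI impI)
    show l: "l \<in> M" using r(3) unfolding Y d.limitin_metric by simp
    fix e :: real assume e: "e > 0"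
    have zM: "z (r n) \<in> M" for n using z(1)[of "r n"] exh_subset[of k] Y by auto
    have "eventually (\<lambda>n. d (z (r n)) l < e / 2) sequentially"
      using r(3) half_gt_zero[OF e] unfolding Y d.limitin_metric
      by (auto elim!: allE[of _ "e / 2"] eventually_mono)
    moreover have "eventually (\<lambda>n. 1 / real (Suc n) < e / 2) sequentially"
    proof -
      obtain n where n: "1 / real (Suc n) < e / 2" using nat_approx_posE[OF half_gt_zero[OF e]] by blast
      have "1 / real (Suc m) < e / 2" if "m \<ge> n" for m
        using frac_le[of 1 1 "real (Suc n)" "real (Suc m)"] n that by simp
      then show ?thesis unfolding eventually_sequentially by blast
    qed
    ultimately show "eventually (\<lambda>n. t n (j n) \<in> M \<and> d (t n (j n)) l < e) sequentially"
    proof eventually_elim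
      case (elim n)
      have "d (t n (j n)) l \<le> d (t n (j n)) (z (r n)) + d (z (r n)) l"
        using d.triangle tM zM l by blast
      then show ?case using elim t(3)[of n "j n"] tM by auto
    qed
  qed
  show "\<exists>r (s :: nat \<Rightarrow> nat \<Rightarrow> 'a). strict_mono (r :: nat \<Rightarrow> nat) \<and>
      (\<forall>n. seq_in X (q ` unique_points) (s n) (x (r n))) \<and>
      (\<forall>j :: nat \<Rightarrow> nat. limitin X (\<lambda>n. s n (j n)) x0 sequentially)"
  proof (intro exI[of _ r] exI[of _ "\<lambda>n j. q (t n j)"] conjI allI)
    show "strict_mono r" by (rule r(1))
    fix n
    show "seq_in X (q ` unique_points) (\<lambda>j. q (t n j)) (x (r n))"
      using continuous_map_limit[OF cont t(2)[of n]] t(1)[of n] z(2)[of "r n"]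
      unfolding seq_in_def comp_def by auto
  next
    fix j :: "nat \<Rightarrow> nat"
    show "limitin X (\<lambda>n. q (t n (j n))) x0 sequentially"
      using continuous_map_limit[OF cont diag[of j]] unfolding \<open>x0 = q l\<close> comp_def .
  qed
qed

end

section \<open>The equivalence\<close>

lemma irreducible_quotient_image_imp_properties:
  fixes X :: "'a topology"
  assumes H: "Hausdorff_space X" and irr: "irreducible_quotient_image TYPE('b) X"
  shows "\<exists>E. sequentially_dense X E \<and> (\<forall>x\<in>E. compact_type_point X x) \<and> property_a X E \<and> property_b X E"
proof -
  obtain Z :: "'b topology" and r where Z: "standard_space Z" "quotient_map Z X r" "irreducible_map Z X r"
    using irr unfolding irreducible_quotient_image_def by blast
  obtain K where K: "compact_network Z K" using standard_space_has_compact_network[OF Z(1)] .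
  interpret irreducible_quotient X Z r K
    using H Z K unfolding standard_space_def by unfold_locales auto
  show ?thesis
    using unique_values_sequentially_dense unique_values_compact_type
      unique_values_property_a unique_values_property_b by blast
qed

lemma properties_imp_star_maps_restrict_irreducibly:
  fixes X :: "'a topology"
  assumes H: "Hausdorff_space X"
    and E: "sequentially_dense X E" "\<And>x. x \<in> E \<Longrightarrow> compact_type_point X x"
      "property_a X E" "property_b X E"
  shows "star_maps_restrict_irreducibly TYPE('b) X"
  unfolding star_maps_restrict_irreducibly_def Let_def
proof (intro allI impI)
  fix Y :: "'b topology" and q
  assume Y: "standard_space Y \<and> quotient_map Y X q"
  then obtain K where K: "compact_network Y K" using standard_space_has_compact_network by blast
  interpret standard_quotient X Y q K
    using H Y K unfolding standard_space_def by unfold_locales auto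
  have "core_determined" using E by (rule properties_imp_core_determined)
  then show "quotient_map (subtopology star (core_set Y X q)) X (star_map q) \<and>
      irreducible_map (subtopology star (core_set Y X q)) X (star_map q)"
    using core_determined_imp_irreducible by simp
qed

lemma irreducible_map_homeomorphic_compose:
  assumes h: "homeomorphic_map Z' Z h" and r: "irreducible_map Z X r"
  shows "irreducible_map Z' X (r \<circ> h)"
  unfolding irreducible_map_def
proof (intro conjI notI)
  have surj: "h ` topspace Z' = topspace Z" and inj: "inj_on h (topspace Z')"
    using h homeomorphic_imp_surjective_map homeomorphic_imp_injective_map by blast+
  show "(r \<circ> h) ` topspace Z' = topspace X"
    using r surj unfolding irreducible_map_def image_comp[symmetric] by simp
  assume "\<exists>W. closedin Z' W \<and> W \<subset> topspace Z' \<and> (r \<circ> h) ` W = topspace X"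
  then obtain W where W: "closedin Z' W" "W \<subset> topspace Z'" "(r \<circ> h) ` W = topspace X" by blast
  have "closedin Z (h ` W)"
    using W(1) h homeomorphic_imp_closed_map unfolding closed_map_def by blast
  moreover have "h ` W \<subset> topspace Z"
    unfolding surj[symmetric] using W(2) inj_on_image_eq_iff[OF inj, of W "topspace Z'"] by blast
  moreover have "r ` (h ` W) = topspace X" using W(3) by (simp add: image_comp)
  ultimately show False using r unfolding irreducible_map_def by blast
qed

lemma irreducible_quotient_image_real:
  assumes "irreducible_quotient_image TYPE('b) X"
  shows "irreducible_quotient_image TYPE(real) X"
proof -
  obtain Z :: "'b topology" and r where Z: "standard_space Z" "quotient_map Z X r" "irreducible_map Z X r"
    using assms unfolding irreducible_quotient_image_def by blast
  obtain Z' :: "real topology" and h where Z': "standard_space Z'" "homeomorphic_map Z' Z h"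
    using standard_space_real_copy[OF Z(1)] .
  have "quotient_map Z' X (r \<circ> h)"
    using Z(2) Z'(2)[unfolded homeomorphic_map_def] by (metis quotient_map_compose)
  moreover have "irreducible_map Z' X (r \<circ> h)"
    using irreducible_map_homeomorphic_compose[OF Z'(2) Z(3)] .
  ultimately show ?thesis using Z'(1) unfolding irreducible_quotient_image_def by blast
qed

lemma star_maps_restrict_imp_irreducible_quotient_image:
  fixes X :: "'a topology" and Y :: "real topology"
  assumes H: "Hausdorff_space X" and Y: "standard_space Y" "quotient_map Y X q"
    and star: "star_maps_restrict_irreducibly TYPE(real) X"
  shows "irreducible_quotient_image TYPE(real set) X"
proof -
  obtain K where K: "compact_network Y K" using standard_space_has_compact_network[OF Y(1)] .
  interpret standard_quotient X Y q K
    using H Y K unfolding standard_space_def by unfold_locales auto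
  let ?V = "subtopology star (core_set Y X q)"
  have "standard_space ?V" using closed_core_set by (rule standard_star_closed)
  moreover have "quotient_map ?V X (star_map q)" "irreducible_map ?V X (star_map q)"
    using star Y unfolding star_maps_restrict_irreducibly_def Let_def by blast+
  ultimately show ?thesis unfolding irreducible_quotient_image_def by blast
qed

theorem corollary5p5:
  fixes X :: "'a topology" and Y0 :: "'y topology" and q0 :: "'y \<Rightarrow> 'a"
  assumes "Hausdorff_space X"
    and "standard_space Y0" and "quotient_map Y0 X q0"
  shows
    "(irreducible_quotient_image TYPE(real) X \<longleftrightarrow>
        (\<exists>E. sequentially_dense X E \<and> (\<forall>x\<in>E. compact_type_point X x) \<and>
             property_a X E \<and> property_b X E)) \<and>
     (irreducible_quotient_image TYPE(real) X \<longleftrightarrow>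
        star_maps_restrict_irreducibly TYPE(real) X) \<and>
     (irreducible_quotient_image TYPE('b) X \<longrightarrow> irreducible_quotient_image TYPE(real) X) \<and>
     (star_maps_restrict_irreducibly TYPE(real) X \<longrightarrow>
        star_maps_restrict_irreducibly TYPE('b) X)"
proof -
  let ?E = "\<exists>E. sequentially_dense X E \<and> (\<forall>x\<in>E. compact_type_point X x) \<and> property_a X E \<and> property_b X E"
  obtain Y :: "real topology" and h where Y: "standard_space Y" "homeomorphic_map Y Y0 h"
    using standard_space_real_copy[OF assms(2)] .
  have q: "quotient_map Y X (q0 \<circ> h)"
    using assms(3) Y(2)[unfolded homeomorphic_map_def] by (metis quotient_map_compose)
  have i_ii: "irreducible_quotient_image TYPE(real) X \<Longrightarrow> ?E"
    using irreducible_quotient_image_imp_properties[OF assms(1)] .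
  have ii_iii: "?E \<Longrightarrow> star_maps_restrict_irreducibly TYPE(real) X"
    using properties_imp_star_maps_restrict_irreducibly[OF assms(1)] by blast
  have ii_iii': "?E \<Longrightarrow> star_maps_restrict_irreducibly TYPE('b) X"
    using properties_imp_star_maps_restrict_irreducibly[OF assms(1)] by blast
  have iii_i: "star_maps_restrict_irreducibly TYPE(real) X \<Longrightarrow> irreducible_quotient_image TYPE(real) X"
    using star_maps_restrict_imp_irreducible_quotient_image[OF assms(1) Y(1) q]
    by (rule irreducible_quotient_image_real)
  have "irreducible_quotient_image TYPE('b) X \<longrightarrow> irreducible_quotient_image TYPE(real) X"
    using irreducible_quotient_image_real by blast
  then show ?thesis using i_ii ii_iii ii_iii' iii_i by argo
qed

end
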